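(* For every $p\in(0,1)$, \[ \liminf_{l\to\infty}\mathrm{Succ}\!\left(\left\lceil\left(\frac{-\log p}{1-p}-\log e\right)l\right\rceil,\,l\right)\ge p, \] where $e$ is the base of the natural logarithm.
   Context: All logarithms are base $2$. Collaborating cryptogenography protocol: there are $n$ players $\mathrm{plr}_1,\dots,\mathrm{plr}_n$; a secret $X$ (finitely supported) and indicators $L_1,\dots,L_n\in\{0,1\}$ ($L_i=1$ means $\mathrm{plr}_i$ knows $X$) have a joint distribution. A protocol $\pi$ specifies, for every possible partial transcript $t^k=(t_1,\dots,t_k)$ (the tuple of the first $k$ messages): whether communication stops; if not, which player $\mathrm{plr}_i$ sends the next message; and probability distributions $p_?$ and $(p_x)_{x}$ on a finite message set (depending on $t^k$). $\mathrm{plr}_i$ draws the next message, with fresh independent randomness, from $p_?$ if $L_i=0$ and from $p_x$ if $L_i=1$ and $X=x$. There is a number $\mathrm{length}(\pi)$ such that the protocol always stops after at most that many messages. $T$ denotes the random full transcript. The game $\mathrm{Succ}$: for real $h\ge0$ and integers $1\le l<n$, let $X$ be uniform on $\{1,\dots,2^{\lceil h\rceil}\}$ and, independently, let $(L_1,\dots,L_n)$ be uniform over the $0/1$-vectors with exactly $l$ ones. The players run a collaborating cryptogenography protocol $\pi$ with transcript $T$. Then Frank outputs a guess $F=f(T)$ of $X$, and Eve, seeing $T$ and $F$, outputs a player index $E=g(T,F)$. The players (and Frank) win if $F=X$ and $L_E=0$; otherwise Eve wins. $\mathrm{Succ}(h,l,n,\pi)=\max_f\min_g\Pr(F=X\text{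 and }L_E=0)$. $\mathrm{Succ}(h,l,n)=\sup_\pi\mathrm{Succ}(h,l,n,\pi)$ and $\mathrm{Succ}(h,l)=\lim_{n\to\infty}\mathrm{Succ}(h,l,n)$ (this limit exists). *)

theory Defs
  imports "HOL-Probability.Probability"
begin

text \<open>Collaborating cryptogenography protocols. Players are indexed 0,...,n-1.
Messages are natural numbers (any finite message set embeds into nat); a partial
transcript is the list of messages sent so far, in order. The knowledge vector
(L_1,...,L_n) is represented by the set S of indices i with L_i = 1.\<close>

record protocol =
  stops   :: "nat list \<Rightarrow> bool"
  speaker :: "nat list \<Rightarrow> nat"
  p_unk   :: "nat list \<Rightarrow> nat pmf"
  p_know  :: "nat list \<Rightarrow> nat \<Rightarrow> nat pmf"
  len     :: nat

definition valid_protocol :: "nat \<Rightarrow> protocol \<Rightarrow> bool" where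
  "valid_protocol n \<pi> \<longleftrightarrow>
     (\<forall>t. \<not> stops \<pi> t \<longrightarrow> speaker \<pi> t < n) \<and>
     (\<forall>t. finite (set_pmf (p_unk \<pi> t))) \<and>
     (\<forall>t x. finite (set_pmf (p_know \<pi> t x))) \<and>
     (\<forall>t. len \<pi> \<le> length t \<longrightarrow> stops \<pi> t)"

definition msg_dist :: "protocol \<Rightarrow> nat \<Rightarrow> nat set \<Rightarrow> nat list \<Rightarrow> nat pmf" where
  "msg_dist \<pi> x S t = (if speaker \<pi> t \<in> S then p_know \<pi> t x else p_unk \<pi> t)"

fun run_from :: "protocol \<Rightarrow> nat \<Rightarrow> nat set \<Rightarrow> nat \<Rightarrow> nat list \<Rightarrow> nat list pmf" where
  "run_from \<pi> x S 0 t = return_pmf t"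
| "run_from \<pi> x S (Suc k) t =
     (if stops \<pi> t then return_pmf t
      else bind_pmf (msg_dist \<pi> x S t) (\<lambda>m. run_from \<pi> x S k (t @ [m])))"

definition transcript :: "protocol \<Rightarrow> nat \<Rightarrow> nat set \<Rightarrow> nat list pmf" where
  "transcript \<pi> x S = run_from \<pi> x S (len \<pi>) []"

definition game_dist :: "real \<Rightarrow> nat \<Rightarrow> nat \<Rightarrow> protocol \<Rightarrow> (nat \<times> nat set \<times> nat list) pmf" where
  "game_dist h l n \<pi> =
     bind_pmf (pmf_of_set {1..2 ^ nat \<lceil>h\<rceil>}) (\<lambda>x.
     bind_pmf (pmf_of_set {S. S \<subseteq> {..<n} \<and> card S = l}) (\<lambda>S.
     map_pmf (\<lambda>t. (x, S, t)) (transcript \<pi> x S)))"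

definition win_prob :: "real \<Rightarrow> nat \<Rightarrow> nat \<Rightarrow> protocol \<Rightarrow> (nat list \<Rightarrow> nat)
                        \<Rightarrow> (nat list \<Rightarrow> nat \<Rightarrow> nat) \<Rightarrow> real" where
  "win_prob h l n \<pi> f g =
     measure_pmf.prob (game_dist h l n \<pi>) {(x, S, t). f t = x \<and> g t (f t) \<notin> S}"

definition Succ_pi :: "real \<Rightarrow> nat \<Rightarrow> nat \<Rightarrow> protocol \<Rightarrow> real" where
  "Succ_pi h l n \<pi> = (SUP f. INF g \<in> {g. \<forall>t y. g t y < n}. win_prob h l n \<pi> f g)"

definition Succ_n :: "real \<Rightarrow> nat \<Rightarrow> nat \<Rightarrow> real" where
  "Succ_n h l n = (SUP \<pi> \<in> {\<pi>. valid_protocol n \<pi>}. Succ_pi h l n \<pi>)"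

definition Succ :: "real \<Rightarrow> nat \<Rightarrow> real" where
  "Succ h l = lim (\<lambda>n. Succ_n h l n)"

end

theory Submission
  imports Defs
begin

text \<open>Every player sends one letter of the alphabet \<open>{0..<d}\<close>: a non-knower a uniform one, a knower the
  letter that a shared codeword of the secret assigns to him. Frank looks for the unique codeword that
  agrees with the transcript in at least \<open>l / (1 - q)\<close> places, where \<open>q < p\<close>. Given the transcript
  and the secret, the knowers are a uniform \<open>l\<close>-subset of the agreeing players, so a player named by
  Eve is a non-knower with probability at least \<open>q\<close>. The number of non-knowers that agree
  is binomial; if its mean slightly exceeds \<open>l q / (1 - q)\<close>, the threshold is met with
  probability tending to 1, while by a Chernoff bound a wrong codeword meets it with probability about
  \<open>2 powr (- l R)\<close>, where \<open>R = - log 2 q / (1 - q) - log 2 (exp 1)\<close> exceeds the rate in the theorem.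
  Since \<open>Succ_n h l n\<close> is nondecreasing in \<open>n\<close>, the limit \<open>Succ h l\<close> is its supremum, so one
  convenient \<open>n\<close> for each \<open>l\<close> suffices.\<close>

section \<open>Achievable winning weights\<close>

lemma prob_bind_pmf:
  assumes "finite A" "set_pmf p \<subseteq> A"
  shows "measure_pmf.prob (bind_pmf p f) X = (\<Sum>m\<in>A. pmf p m * measure_pmf.prob (f m) X)"
proof -
  have "ennreal (measure_pmf.prob (bind_pmf p f) X)
      = (\<integral>\<^sup>+m. ennreal (measure_pmf.prob (f m) X) \<partial>p)"
    by (simp add: measure_pmf.emeasure_eq_measure[symmetric])
  also have "\<dots> = (\<Sum>m\<in>A. ennreal (measure_pmf.prob (f m) X) * ennreal (pmf p m))"
    using assms by (intro nn_integral_measure_pmf_support) auto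
  also have "\<dots> = ennreal (\<Sum>m\<in>A. pmf p m * measure_pmf.prob (f m) X)"
    by (simp add: ennreal_mult'[symmetric] sum_ennreal mult.commute)
  finally show ?thesis
    by (subst (asm) ennreal_inj) (auto intro!: sum_nonneg)
qed

text \<open>Fuel that covers all remaining messages lets the protocol reach a stop, so extra fuel
  changes nothing. Branches of different lengths can therefore share one amount of fuel.\<close>

lemma run_from_add:
  assumes "\<And>t. len \<pi> \<le> length t \<Longrightarrow> stops \<pi> t" "len \<pi> \<le> k + length t"
  shows "run_from \<pi> x S (k + j) t = run_from \<pi> x S k t"
  using assms(2)
proof (induction k arbitrary: t)
  case 0
  then have "stops \<pi> t" using assms(1) by simp
  then show ?case by (cases j) auto
next
  case (Suc k)
  have "run_from \<pi> x S (k + j) (t @ [m]) = run_from \<pi> x S k (t @ [m])" for m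
    using Suc.prems by (intro Suc.IH) auto
  then show ?case by simp
qed

lemma transcript_eq_run_from:
  assumes "valid_protocol n \<pi>" "len \<pi> \<le> k"
  shows "transcript \<pi> x S = run_from \<pi> x S k []"
proof -
  obtain j where k: "k = len \<pi> + j" using assms(2) le_Suc_ex by blast
  show ?thesis unfolding transcript_def k
    by (rule run_from_add[symmetric]) (use assms(1) in \<open>auto simp: valid_protocol_def\<close>)
qed

text \<open>Conditioning on the secret and the knowers separates the protocol from the prior, which
  can then be replaced by an arbitrary weight.\<close>

definition win_at :: "protocol \<Rightarrow> (nat list \<Rightarrow> nat) \<Rightarrow> (nat list \<Rightarrow> nat \<Rightarrow> nat) \<Rightarrow> nat \<Rightarrow> nat set \<Rightarrow> real" where
  "win_at \<pi> f g x S = measure_pmf.prob (transcript \<pi> x S) {t. f t = x \<and> g t (f t) \<notin> S}"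

lemma win_at_nonneg: "0 \<le> win_at \<pi> f g x S"
  by (simp add: win_at_def)

definition knower_sets :: "nat \<Rightarrow> nat \<Rightarrow> nat set set" where
  "knower_sets n l = {S. S \<subseteq> {..<n} \<and> card S = l}"

lemma finite_knower_sets [simp]: "finite (knower_sets n l)"
  unfolding knower_sets_def by (rule finite_subset[of _ "Pow {..<n}"]) auto

lemma card_knower_sets: "card (knower_sets n l) = n choose l"
  unfolding knower_sets_def using n_subsets[of "{..<n}" l] by simp

text \<open>The weight \<^term>\<open>w\<close> is an unnormalised distribution of the secret and the knowers, such as the
  part of the prior that is compatible with a partial transcript. Working with unnormalised weights
  makes values additive over the possible next messages.\<close>

definition achievable ::
    "nat \<Rightarrow> nat \<Rightarrow> nat \<Rightarrow> (nat \<Rightarrow> nat set \<Rightarrow> real) \<Rightarrow> real \<Rightarrow> bool" where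
  "achievable M l n w c \<longleftrightarrow> (\<exists>\<pi> f. valid_protocol n \<pi> \<and>
     (\<forall>g. (\<forall>t y. g t y < n) \<longrightarrow>
        c \<le> (\<Sum>x\<in>{1..M}. \<Sum>S\<in>knower_sets n l. w x S * win_at \<pi> f g x S)))"

lemma achievable_mono:
  assumes "achievable M l n w c" "c' \<le> c"
    and "\<And>x S. x \<in> {1..M} \<Longrightarrow> S \<in> knower_sets n l \<Longrightarrow> w x S \<le> w' x S"
  shows "achievable M l n w' c'"
proof -
  from assms(1) obtain \<pi> f where v: "valid_protocol n \<pi>" and
    c: "\<And>g. (\<forall>t y. g t y < n) \<Longrightarrow>
        c \<le> (\<Sum>x\<in>{1..M}. \<Sum>S\<in>knower_sets n l. w x S * win_at \<pi> f g x S)"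
    unfolding achievable_def by blast
  have "c' \<le> (\<Sum>x\<in>{1..M}. \<Sum>S\<in>knower_sets n l. w' x S * win_at \<pi> f g x S)"
    if "\<forall>t y. g t y < n" for g
  proof -
    have "(\<Sum>x\<in>{1..M}. \<Sum>S\<in>knower_sets n l. w x S * win_at \<pi> f g x S)
       \<le> (\<Sum>x\<in>{1..M}. \<Sum>S\<in>knower_sets n l. w' x S * win_at \<pi> f g x S)"
      by (intro sum_mono mult_right_mono assms win_at_nonneg)
    with c[OF that] assms(2) show ?thesis by linarith
  qed
  with v show ?thesis unfolding achievable_def by blast
qed

lemma achievable_scale:
  assumes "achievable M l n w c" "0 \<le> a"
  shows "achievable M l n (\<lambda>x S. a * w x S) (a * c)"
proof -
  from assms(1) obtain \<pi> f where v: "valid_protocol n \<pi>" and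
    c: "\<And>g. (\<forall>t y. g t y < n) \<Longrightarrow>
        c \<le> (\<Sum>x\<in>{1..M}. \<Sum>S\<in>knower_sets n l. w x S * win_at \<pi> f g x S)"
    unfolding achievable_def by blast
  have "a * c \<le> (\<Sum>x\<in>{1..M}. \<Sum>S\<in>knower_sets n l. a * w x S * win_at \<pi> f g x S)"
    if "\<forall>t y. g t y < n" for g
    using mult_left_mono[OF c[OF that] assms(2)] by (simp add: sum_distrib_left mult.assoc)
  with v show ?thesis unfolding achievable_def by blast
qed

section \<open>Building protocols: silence and a first message\<close>

definition silent :: protocol where
  "silent = \<lparr>stops = \<lambda>_. True, speaker = \<lambda>_. 0, p_unk = \<lambda>_. return_pmf 0,
     p_know = \<lambda>_ _. return_pmf 0, len = 0\<rparr>"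

lemma valid_silent: "valid_protocol n silent"
  by (simp add: silent_def valid_protocol_def)

text \<open>With no message sent and the guess fixed to \<open>y\<close>, Eve can only choose one
  player \<open>i\<close>, and the players keep the weight of the knower sets that avoid
  \<open>i\<close>.\<close>

lemma achievable_leaf:
  assumes w: "\<And>x S. x \<in> {1..M} \<Longrightarrow> S \<in> knower_sets n l \<Longrightarrow> 0 \<le> w x S"
    and y: "y \<in> {1..M}"
    and c: "\<And>i. i < n \<Longrightarrow> c \<le> (\<Sum>S\<in>{S \<in> knower_sets n l. i \<notin> S}. w y S)"
  shows "achievable M l n w c"
proof -
  have "c \<le> (\<Sum>x\<in>{1..M}. \<Sum>S\<in>knower_sets n l. w x S * win_at silent (\<lambda>_. y) g x S)"
    if g: "\<forall>t y. g t y < n" for g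
  proof -
    have "c \<le> (\<Sum>S\<in>{S \<in> knower_sets n l. g [] y \<notin> S}. w y S)"
      using c g by blast
    also have "\<dots> = (\<Sum>S\<in>knower_sets n l. if g [] y \<notin> S then w y S else 0)"
      by (simp add: sum.inter_filter)
    also have "\<dots> = (\<Sum>S\<in>knower_sets n l. w y S * win_at silent (\<lambda>_. y) g y S)"
      by (intro sum.cong) (auto simp: win_at_def transcript_def silent_def indicator_def)
    also have "\<dots> \<le> (\<Sum>x\<in>{1..M}. \<Sum>S\<in>knower_sets n l. w x S * win_at silent (\<lambda>_. y) g x S)"
      by (rule member_le_sum[OF y]) (auto intro!: sum_nonneg mult_nonneg_nonneg w win_at_nonneg)
    finally show ?thesis .
  qed
  then show ?thesis unfolding achievable_def using valid_silent by blast
qed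

lemma achievable_0:
  assumes "\<And>x S. x \<in> {1..M} \<Longrightarrow> S \<in> knower_sets n l \<Longrightarrow> 0 \<le> w x S"
  shows "achievable M l n w 0"
proof -
  have "0 \<le> (\<Sum>x\<in>{1..M}. \<Sum>S\<in>knower_sets n l. w x S * win_at silent (\<lambda>_. 0) g x S)" for g
    by (intro sum_nonneg mult_nonneg_nonneg win_at_nonneg assms)
  then show ?thesis unfolding achievable_def using valid_silent by blast
qed

text \<open>Messages outside \<open>A\<close> stop at once, so that the length is bounded although
  \<open>P\<close> is indexed by all naturals. The sum of the lengths over \<open>A\<close> serves
  as a bound for each of them.\<close>

definition prepend :: "nat \<Rightarrow> nat pmf \<Rightarrow> (nat \<Rightarrow> nat pmf) \<Rightarrow> nat set \<Rightarrow> (nat \<Rightarrow> protocol) \<Rightarrow> protocol" where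
  "prepend i pu pk A P = \<lparr>
     stops = \<lambda>t. case t of [] \<Rightarrow> False | m # t' \<Rightarrow> m \<notin> A \<or> stops (P m) t',
     speaker = \<lambda>t. case t of [] \<Rightarrow> i | m # t' \<Rightarrow> speaker (P m) t',
     p_unk = \<lambda>t. case t of [] \<Rightarrow> pu | m # t' \<Rightarrow> p_unk (P m) t',
     p_know = \<lambda>t x. case t of [] \<Rightarrow> pk x | m # t' \<Rightarrow> p_know (P m) t' x,
     len = Suc (\<Sum>m\<in>A. len (P m))\<rparr>"

lemma valid_prepend:
  assumes "i < n" "finite A" "finite (set_pmf pu)" "\<And>x. finite (set_pmf (pk x))"
    "\<And>m. valid_protocol n (P m)"
  shows "valid_protocol n (prepend i pu pk A P)"
proof -
  have "len (P m) \<le> (\<Sum>m\<in>A. len (P m))" if "m \<in> A" for m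
    using assms(2) that by (intro member_le_sum) auto
  then have "stops (P m) t" if "m \<in> A" "(\<Sum>m\<in>A. len (P m)) \<le> length t" for m t
    using that assms(5) order.trans unfolding valid_protocol_def by blast
  then show ?thesis
    using assms unfolding valid_protocol_def prepend_def
    by (auto split: list.splits)
qed

lemma run_from_prepend:
  assumes "m \<in> A"
  shows "run_from (prepend i pu pk A P) x S k (m # t) = map_pmf ((#) m) (run_from (P m) x S k t)"
proof (induction k arbitrary: t)
  case 0
  then show ?case by simp
next
  case (Suc k)
  have [simp]: "stops (prepend i pu pk A P) (m # t) = stops (P m) t"
    "msg_dist (prepend i pu pk A P) x S (m # t) = msg_dist (P m) x S t"
    using assms by (auto simp: prepend_def msg_dist_def)
  show ?case by (simp add: Suc.IH map_bind_pmf)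
qed

text \<open>The law of total probability over the first message \<open>m\<close>: Frank continues
  with \<open>F m\<close>, and Eve's strategy, having seen \<open>m\<close>, restricts to one
  against \<open>P m\<close>.\<close>

lemma win_at_prepend:
  assumes fin: "finite A" and sub: "set_pmf pu \<subseteq> A" "\<And>x. set_pmf (pk x) \<subseteq> A"
    and v: "\<And>m. valid_protocol n (P m)"
  shows "win_at (prepend i pu pk A P) (\<lambda>t. F (hd t) (tl t)) g x S
    = (\<Sum>m\<in>A. pmf (if i \<in> S then pk x else pu) m * win_at (P m) (F m) (\<lambda>t. g (m # t)) x S)"
proof -
  let ?Q = "prepend i pu pk A P" and ?L = "\<Sum>m\<in>A. len (P m)"
  have L: "len (P m) \<le> ?L" if "m \<in> A" for m
    using fin that by (intro member_le_sum) auto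
  have dist: "msg_dist ?Q x S [] = (if i \<in> S then pk x else pu)"
    by (simp add: msg_dist_def prepend_def)
  have "transcript ?Q x S = bind_pmf (msg_dist ?Q x S []) (\<lambda>m. run_from ?Q x S ?L [m])"
  proof -
    have "len ?Q = Suc ?L" "\<not> stops ?Q []" by (auto simp: prepend_def)
    then show ?thesis by (simp add: transcript_def)
  qed
  also have "\<dots> = bind_pmf (if i \<in> S then pk x else pu) (\<lambda>m. map_pmf ((#) m) (transcript (P m) x S))"
    unfolding dist
  proof (intro bind_pmf_cong refl)
    fix m assume "m \<in> set_pmf (if i \<in> S then pk x else pu)"
    then have "m \<in> A" using sub by (auto split: if_splits)
    then show "run_from ?Q x S ?L [m] = map_pmf ((#) m) (transcript (P m) x S)"
      by (simp add: run_from_prepend transcript_eq_run_from[OF v L])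
  qed
  finally show ?thesis
    using sub unfolding win_at_def by (simp add: prob_bind_pmf[OF fin] vimage_def)
qed

text \<open>A message multiplies the weight by its likelihood. Every branch may use its own protocol
  and guess, and each strategy of Eve restricts to one in every branch, so the branch values add
  up.\<close>

lemma achievable_split:
  fixes pu :: "nat pmf" and pk :: "nat \<Rightarrow> nat pmf"
  assumes i: "i < n" and fin: "finite A" and sub: "set_pmf pu \<subseteq> A" "\<And>x. set_pmf (pk x) \<subseteq> A"
    and c: "\<And>m. m \<in> A \<Longrightarrow>
      achievable M l n (\<lambda>x S. w x S * pmf (if i \<in> S then pk x else pu) m) (c m)"
  shows "achievable M l n w (\<Sum>m\<in>A. c m)"
proof -
  \<comment> \<open>Off \<open>A\<close> only validity is demanded, so that \<open>P\<close> and
    \<open>F\<close> can be chosen for all naturals at once.\<close>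
  define good where "good m \<pi> f \<longleftrightarrow> valid_protocol n \<pi> \<and> (m \<in> A \<longrightarrow> (\<forall>g. (\<forall>t y. g t y < n) \<longrightarrow>
        c m \<le> (\<Sum>x\<in>{1..M}. \<Sum>S\<in>knower_sets n l.
          w x S * pmf (if i \<in> S then pk x else pu) m * win_at \<pi> f g x S)))" for m \<pi> f
  have "\<exists>\<pi> f. good m \<pi> f" for m
  proof (cases "m \<in> A")
    case True
    then show ?thesis using c[OF True] unfolding good_def achievable_def by blast
  qed (use valid_silent in \<open>auto simp: good_def\<close>)
  then obtain P F where PF': "\<And>m. good m (P m) (F m)"
    by metis
  from PF' have v: "\<And>m. valid_protocol n (P m)" and
    PF: "\<And>m g. m \<in> A \<Longrightarrow> \<forall>t y. g t y < n \<Longrightarrow>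
        c m \<le> (\<Sum>x\<in>{1..M}. \<Sum>S\<in>knower_sets n l.
          w x S * pmf (if i \<in> S then pk x else pu) m * win_at (P m) (F m) g x S)"
    unfolding good_def by blast+
  let ?Q = "prepend i pu pk A P" and ?f = "\<lambda>t. F (hd t) (tl t)"
  have "(\<Sum>m\<in>A. c m) \<le> (\<Sum>x\<in>{1..M}. \<Sum>S\<in>knower_sets n l. w x S * win_at ?Q ?f g x S)"
    if g: "\<forall>t y. g t y < n" for g
  proof -
    have "(\<Sum>m\<in>A. c m) \<le> (\<Sum>m\<in>A. \<Sum>x\<in>{1..M}. \<Sum>S\<in>knower_sets n l.
          w x S * pmf (if i \<in> S then pk x else pu) m * win_at (P m) (F m) (\<lambda>t. g (m # t)) x S)"
      using g by (intro sum_mono PF) auto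
    also have "\<dots> = (\<Sum>x\<in>{1..M}. \<Sum>m\<in>A. \<Sum>S\<in>knower_sets n l.
          w x S * pmf (if i \<in> S then pk x else pu) m * win_at (P m) (F m) (\<lambda>t. g (m # t)) x S)"
      by (rule sum.swap)
    also have "\<dots> = (\<Sum>x\<in>{1..M}. \<Sum>S\<in>knower_sets n l. \<Sum>m\<in>A.
          w x S * pmf (if i \<in> S then pk x else pu) m * win_at (P m) (F m) (\<lambda>t. g (m # t)) x S)"
      by (intro sum.cong refl sum.swap)
    also have "\<dots> = (\<Sum>x\<in>{1..M}. \<Sum>S\<in>knower_sets n l. w x S * win_at ?Q ?f g x S)"
      by (simp add: win_at_prepend[OF fin sub v, where F = F] sum_distrib_left mult.assoc)
    finally show ?thesis .
  qed
  moreover have "valid_protocol n ?Q"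
    using i fin sub v by (intro valid_prepend) (auto intro: finite_subset)
  ultimately show ?thesis unfolding achievable_def by blast
qed

section \<open>Passage between achievable values and \<open>Succ_n\<close>\<close>

abbreviation num_secrets :: "real \<Rightarrow> nat" where
  "num_secrets h \<equiv> 2 ^ nat \<lceil>h\<rceil>"

definition prior :: "nat \<Rightarrow> nat \<Rightarrow> nat \<Rightarrow> real" where
  "prior M l n = 1 / (real M * real (n choose l))"

lemma prior_nonneg: "0 \<le> prior M l n"
  by (simp add: prior_def)

lemma win_prob_eq_sum:
  assumes "l \<le> n"
  shows "win_prob h l n \<pi> f g =
    (\<Sum>x\<in>{1..num_secrets h}. \<Sum>S\<in>knower_sets n l. prior (num_secrets h) l n * win_at \<pi> f g x S)"
proof -
  let ?M = "num_secrets h" and ?B = "{(x, S, t). f t = x \<and> g t (f t) \<notin> S}"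
  have "knower_sets n l \<noteq> {}"
    using card_knower_sets[of n l] assms by (metis binomial_eq_0_iff card.empty not_le)
  then have pS: "set_pmf (pmf_of_set (knower_sets n l)) \<subseteq> knower_sets n l"
      "pmf (pmf_of_set (knower_sets n l)) S = 1 / real (n choose l)" if "S \<in> knower_sets n l" for S
    using that by (auto simp: card_knower_sets)
  have inner: "measure_pmf.prob (bind_pmf (pmf_of_set (knower_sets n l))
        (\<lambda>S. map_pmf (\<lambda>t. (x, S, t)) (transcript \<pi> x S))) ?B
      = (\<Sum>S\<in>knower_sets n l. 1 / real (n choose l) * win_at \<pi> f g x S)" for x
    using pS \<open>knower_sets n l \<noteq> {}\<close>
    by (subst prob_bind_pmf[of "knower_sets n l"]) (auto simp: win_at_def vimage_def intro!: sum.cong)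
  have "win_prob h l n \<pi> f g = (\<Sum>x\<in>{1..?M}. 1 / real ?M *
      (\<Sum>S\<in>knower_sets n l. 1 / real (n choose l) * win_at \<pi> f g x S))"
    unfolding win_prob_def game_dist_def knower_sets_def[symmetric]
    by (subst prob_bind_pmf[of "{1..?M}"]) (auto simp: inner intro!: sum.cong)
  then show ?thesis
    by (simp add: sum_distrib_left prior_def)
qed

lemma win_prob_bounds: "0 \<le> win_prob h l n \<pi> f g" "win_prob h l n \<pi> f g \<le> 1"
  by (auto simp: win_prob_def)

lemma bdd_below_win_prob: "bdd_below (win_prob h l n \<pi> f ` A)"
  by (rule bdd_belowI[of _ 0]) (auto simp: win_prob_bounds)

lemma Inf_win_prob_le_1:
  assumes "0 < n"
  shows "(INF g\<in>{g. \<forall>t y. g t y < n}. win_prob h l n \<pi> f g) \<le> 1"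
  by (rule cINF_lower2[OF bdd_below_win_prob, of "\<lambda>_ _. 0"]) (use assms in \<open>auto simp: win_prob_bounds\<close>)

lemma bdd_above_Inf_win_prob:
  assumes "0 < n"
  shows "bdd_above (range (\<lambda>f. INF g\<in>{g. \<forall>t y. g t y < n}. win_prob h l n \<pi> f g))"
  by (rule bdd_aboveI[of _ 1]) (use Inf_win_prob_le_1[OF assms] in auto)

lemma Succ_pi_le_1: "0 < n \<Longrightarrow> Succ_pi h l n \<pi> \<le> 1"
  unfolding Succ_pi_def by (rule cSUP_least) (auto intro: Inf_win_prob_le_1)

lemma bdd_above_Succ_pi: "0 < n \<Longrightarrow> bdd_above (Succ_pi h l n ` A)"
  by (rule bdd_aboveI[of _ 1]) (auto intro: Succ_pi_le_1)

lemma Succ_n_le_1: "0 < n \<Longrightarrow> Succ_n h l n \<le> 1"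
  unfolding Succ_n_def by (rule cSUP_least) (auto intro: Succ_pi_le_1 valid_silent)

lemma le_Succ_n:
  assumes "0 < n" "l \<le> n" "achievable (num_secrets h) l n (\<lambda>_ _. prior (num_secrets h) l n) c"
  shows "c \<le> Succ_n h l n"
proof -
  from assms obtain \<pi> f where v: "valid_protocol n \<pi>" and
    c: "\<And>g. (\<forall>t y. g t y < n) \<Longrightarrow> c \<le> win_prob h l n \<pi> f g"
    unfolding achievable_def win_prob_eq_sum[OF assms(2)] by blast
  have "c \<le> (INF g\<in>{g. \<forall>t y. g t y < n}. win_prob h l n \<pi> f g)"
    using assms(1) by (intro cINF_greatest) (auto intro: c)
  also have "\<dots> \<le> Succ_pi h l n \<pi>"
    unfolding Succ_pi_def by (rule cSUP_upper[OF UNIV_I bdd_above_Inf_win_prob[OF assms(1)]])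
  also have "\<dots> \<le> Succ_n h l n"
    unfolding Succ_n_def by (rule cSUP_upper[OF _ bdd_above_Succ_pi[OF assms(1)]]) (use v in simp)
  finally show ?thesis .
qed

text \<open>The converse of \<open>le_Succ_n\<close>, with a strict inequality because the suprema
  over protocols and guesses need not be attained.\<close>

lemma less_Succ_n_imp_achievable:
  assumes "0 < n" "l \<le> n" "c < Succ_n h l n"
  shows "achievable (num_secrets h) l n (\<lambda>_ _. prior (num_secrets h) l n) c"
proof -
  obtain \<pi> where v: "valid_protocol n \<pi>" and "c < Succ_pi h l n \<pi>"
    using assms(3) unfolding Succ_n_def
    by (subst (asm) less_cSUP_iff) (auto intro: valid_silent bdd_above_Succ_pi[OF assms(1)])
  then obtain f where f: "c < (INF g\<in>{g. \<forall>t y. g t y < n}. win_prob h l n \<pi> f g)"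
    unfolding Succ_pi_def by (subst (asm) less_cSUP_iff) (auto intro: bdd_above_Inf_win_prob[OF assms(1)])
  have "c \<le> win_prob h l n \<pi> f g" if "\<forall>t y. g t y < n" for g
    using cINF_lower[OF bdd_below_win_prob, of g "{g. \<forall>t y. g t y < n}" h l n \<pi> f] that f by simp
  with v show ?thesis
    unfolding achievable_def win_prob_eq_sum[OF assms(2)] by blast
qed

section \<open>Monotonicity in the number of players\<close>

text \<open>The increasing enumeration of all indices but \<open>i\<close>, used to rename
  \<open>n\<close> players as the players other than \<open>i\<close> among
  \<open>Suc n\<close>.\<close>

definition skip :: "nat \<Rightarrow> nat \<Rightarrow> nat" where
  "skip i j = (if j < i then j else Suc j)"

lemma inj_skip: "inj (skip i)"
  by (auto simp: inj_def skip_def split: if_splits)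

lemma skip_neq: "skip i j \<noteq> i"
  by (auto simp: skip_def)

lemma skip_surj:
  assumes "j \<noteq> i" "j < Suc n" "i < Suc n"
  shows "\<exists>k<n. j = skip i k"
  using assms by (intro exI[of _ "if j < i then j else j - 1"]) (auto simp: skip_def)

lemma run_from_skip:
  "run_from (\<pi>\<lparr>speaker := \<lambda>t. skip i (speaker \<pi> t)\<rparr>) x S k t = run_from \<pi> x (skip i -` S) k t"
  by (induction k arbitrary: t) (auto simp: msg_dist_def)

lemma bij_betw_image_skip:
  assumes "i < Suc n"
  shows "bij_betw (image (skip i)) (knower_sets n l) {S \<in> knower_sets (Suc n) l. i \<notin> S}"
proof (rule bij_betwI[where g = "vimage (skip i)"])
  have "skip i j < Suc n" if "j < n" for j using that by (auto simp: skip_def)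
  then show "image (skip i) \<in> knower_sets n l \<rightarrow> {S \<in> knower_sets (Suc n) l. i \<notin> S}"
    using inj_skip[of i] skip_neq[of i, symmetric]
    by (auto simp: knower_sets_def card_image inj_on_subset)
  have eq: "skip i ` (skip i -` S) = S" if "S \<in> {S \<in> knower_sets (Suc n) l. i \<notin> S}" for S
  proof (intro equalityI subsetI)
    fix j assume j: "j \<in> S"
    with that have "j \<noteq> i" "j < Suc n" by (auto simp: knower_sets_def)
    then obtain k where "j = skip i k" using assms skip_surj by blast
    with j show "j \<in> skip i ` (skip i -` S)" by auto
  qed auto
  then show "\<And>S. S \<in> {S \<in> knower_sets (Suc n) l. i \<notin> S} \<Longrightarrow> skip i ` (skip i -` S) = S" .
  show "vimage (skip i) \<in> {S \<in> knower_sets (Suc n) l. i \<notin> S} \<rightarrow> knower_sets n l"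
  proof
    fix S assume S: "S \<in> {S \<in> knower_sets (Suc n) l. i \<notin> S}"
    have "card (skip i -` S) = card S"
      using card_image[OF inj_on_subset[OF inj_skip[of i] subset_UNIV], of "skip i -` S"] eq[OF S]
      by simp
    moreover have "skip i -` S \<subseteq> {..<n}"
      using S assms by (auto simp: knower_sets_def skip_def split: if_splits)
    ultimately show "skip i -` S \<in> knower_sets n l"
      using S by (simp add: knower_sets_def)
  qed
qed (use inj_skip in \<open>auto simp: inj_vimage_image_eq\<close>)

text \<open>The players other than \<open>i\<close> run the given protocol under new names. The
  weight vanishes on knower sets containing \<open>i\<close>, so Eve gains nothing from being able
  to name \<open>i\<close>.\<close>

lemma achievable_skip:
  assumes i: "i < Suc n" and n: "0 < n"
    and w: "\<And>x S. x \<in> {1..M} \<Longrightarrow> S \<in> knower_sets (Suc n) l \<Longrightarrow> 0 \<le> w x S"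
    and ach: "achievable M l n (\<lambda>x S. w x (skip i ` S)) c"
  shows "achievable M l (Suc n) (\<lambda>x S. if i \<in> S then 0 else w x S) c"
proof -
  from ach obtain \<pi> f where v: "valid_protocol n \<pi>" and
    c: "\<And>g. (\<forall>t y. g t y < n) \<Longrightarrow>
        c \<le> (\<Sum>x\<in>{1..M}. \<Sum>S\<in>knower_sets n l. w x (skip i ` S) * win_at \<pi> f g x S)"
    unfolding achievable_def by blast
  let ?Q = "\<pi>\<lparr>speaker := \<lambda>t. skip i (speaker \<pi> t)\<rparr>"
  have "c \<le> (\<Sum>x\<in>{1..M}. \<Sum>S\<in>knower_sets (Suc n) l. (if i \<in> S then 0 else w x S) * win_at ?Q f g x S)"
    if g: "\<forall>t y. g t y < Suc n" for g
  proof -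
    \<comment> \<open>Eve's strategy in the old names. Naming \<open>i\<close> loses for her, so any
      default may replace it; 0 is a player since \<open>0 < n\<close>.\<close>
    define g' where "g' t y = (if g t y = i then 0 else (SOME k. k < n \<and> g t y = skip i k))" for t y
    have g': "g' t y < n \<and> g t y = skip i (g' t y)" if gi: "g t y \<noteq> i" for t y
    proof -
      have "\<exists>k. k < n \<and> g t y = skip i k"
        using skip_surj[of "g t y" i n] gi g i by blast
      then show ?thesis using gi someI_ex[of "\<lambda>k. k < n \<and> g t y = skip i k"] unfolding g'_def by simp
    qed
    have "g' t y < n" for t y
      using g' n by (cases "g t y = i") (auto simp: g'_def)
    then have "c \<le> (\<Sum>x\<in>{1..M}. \<Sum>S\<in>knower_sets n l. w x (skip i ` S) * win_at \<pi> f g' x S)"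
      by (intro c) auto
    also have "\<dots> \<le> (\<Sum>x\<in>{1..M}. \<Sum>S\<in>knower_sets n l. w x (skip i ` S) * win_at ?Q f g x (skip i ` S))"
    proof (intro sum_mono mult_left_mono)
      fix x S assume x: "x \<in> {1..M}" and S: "S \<in> knower_sets n l"
      have "transcript ?Q x (skip i ` S) = transcript \<pi> x S"
        by (simp add: transcript_def run_from_skip inj_vimage_image_eq[OF inj_skip])
      moreover have "g t y \<notin> skip i ` S" if "g' t y \<notin> S" for t y
        using that g'[of t y] inj_skip[of i] skip_neq[of i] by (auto simp: inj_eq)
      ultimately show "win_at \<pi> f g' x S \<le> win_at ?Q f g x (skip i ` S)"
        unfolding win_at_def by (auto intro!: measure_pmf.finite_measure_mono)
      show "0 \<le> w x (skip i ` S)"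
        using bij_betwE[OF bij_betw_image_skip[OF i]] S x by (intro w) auto
    qed
    also have "\<dots> = (\<Sum>x\<in>{1..M}. \<Sum>S\<in>{S \<in> knower_sets (Suc n) l. i \<notin> S}. w x S * win_at ?Q f g x S)"
      by (intro sum.cong refl sum.reindex_bij_betw bij_betw_image_skip[OF i])
    also have "\<dots> = (\<Sum>x\<in>{1..M}. \<Sum>S\<in>knower_sets (Suc n) l. (if i \<in> S then 0 else w x S) * win_at ?Q f g x S)"
      by (intro sum.cong refl sum.mono_neutral_cong_left) auto
    finally show ?thesis .
  qed
  moreover have "valid_protocol (Suc n) ?Q"
    using v by (auto simp: valid_protocol_def skip_def)
  ultimately show ?thesis unfolding achievable_def by blast
qed

section \<open>Rounds of random resignation\<close>

context
  fixes \<delta> a v :: real and M l n :: nat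
  assumes \<delta>: "0 < \<delta>" "\<delta> < 1" and a: "0 \<le> a" and v: "0 \<le> v"
    and ach: "\<And>i. i < n \<Longrightarrow> achievable M l n (\<lambda>x S. if i \<in> S then 0 else a) v"
begin

text \<open>Message 1 is a resignation, sent only by non-knowers, with probability
  \<open>\<delta>\<close>. The power of \<open>1 - \<delta>\<close> is the likelihood that no player
  before \<open>j\<close> has resigned. If \<open>j\<close> resigns, the weight is at least
  \<open>\<delta> * (1 - \<delta>) ^ n\<close> times the one for which \<open>v\<close> is
  achievable.\<close>

lemma achievable_leave_step:
  assumes j: "j < n"
    and e: "achievable M l n (\<lambda>x S. a * (1 - \<delta>) ^ card ({..<Suc j} - S)) e"
  shows "achievable M l n (\<lambda>x S. a * (1 - \<delta>) ^ card ({..<j} - S)) (e + \<delta> * (1 - \<delta>) ^ n * v)"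
proof -
  define pu :: "nat pmf" where "pu = map_pmf of_bool (bernoulli_pmf \<delta>)"
  have pu: "pmf pu 0 = 1 - \<delta>" "pmf pu 1 = \<delta>" "set_pmf pu \<subseteq> {0, 1}"
  proof -
    have "of_bool -` {0::nat} = {False}" "of_bool -` {1::nat} = {True}" by (auto simp: of_bool_def split: if_splits)
    then show "pmf pu 0 = 1 - \<delta>" "pmf pu 1 = \<delta>"
      using \<delta> by (simp_all add: pu_def pmf_map measure_pmf_single)
  qed (auto simp: pu_def)
  let ?c = "\<lambda>m::nat. if m = 0 then e else \<delta> * (1 - \<delta>) ^ n * v"
  have card_Suc: "card ({..<Suc j} - S) = card ({..<j} - S) + of_bool (j \<notin> S)" for S
    by (auto simp: lessThan_Suc insert_Diff_if)
  have "achievable M l n (\<lambda>x S. a * (1 - \<delta>) ^ card ({..<j} - S)) (\<Sum>m\<in>{0,1}. ?c m)"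
  proof (rule achievable_split[where i = j and pu = pu and pk = "\<lambda>_. return_pmf 0"])
    fix m :: nat assume "m \<in> {0, 1}"
    then consider "m = 0" | "m = 1" by auto
    then show "achievable M l n (\<lambda>x S. a * (1 - \<delta>) ^ card ({..<j} - S) *
        pmf (if j \<in> S then return_pmf 0 else pu) m) (?c m)"
    proof cases
      case 1
      have "achievable M l n (\<lambda>x S. a * (1 - \<delta>) ^ card ({..<j} - S) *
          pmf (if j \<in> S then return_pmf 0 else pu) 0) e"
        using e by (rule achievable_mono) (auto simp: card_Suc pu)
      then show ?thesis using 1 by simp
    next
      case 2
      have "achievable M l n (\<lambda>x S. (\<delta> * (1 - \<delta>) ^ n) * (if j \<in> S then 0 else a)) (\<delta> * (1 - \<delta>) ^ n * v)"
        using \<delta> by (intro achievable_scale ach j) auto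
      then have "achievable M l n (\<lambda>x S. a * (1 - \<delta>) ^ card ({..<j} - S) *
          pmf (if j \<in> S then return_pmf 0 else pu) 1) (\<delta> * (1 - \<delta>) ^ n * v)"
      proof (rule achievable_mono)
        fix S :: "nat set"
        have "card ({..<j} - S) \<le> n"
          using card_mono[of "{..<j}" "{..<j} - S"] j by auto
        then have "(1 - \<delta>) ^ n \<le> (1 - \<delta>) ^ card ({..<j} - S)"
          using \<delta> by (intro power_decreasing) auto
        then have "(\<delta> * a) * (1 - \<delta>) ^ n \<le> (\<delta> * a) * (1 - \<delta>) ^ card ({..<j} - S)"
          using \<delta> a by (intro mult_left_mono) auto
        then show "\<delta> * (1 - \<delta>) ^ n * (if j \<in> S then 0 else a)
            \<le> a * (1 - \<delta>) ^ card ({..<j} - S) * pmf (if j \<in> S then return_pmf 0 else pu) 1"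
          by (auto simp: pu(2)[unfolded One_nat_def] mult_ac)
      qed auto
      then show ?thesis using 2 by simp
    qed
  qed (use j pu in auto)
  then show ?thesis by simp
qed

text \<open>Backward induction over the speakers of one round. After a round without resignation
  every knower set has lost the same factor, one \<open>1 - \<delta>\<close> for each of the
  \<open>n - l\<close> non-knowers, so the original weight returns scaled and the play for
  \<open>e\<close> can follow.\<close>

lemma achievable_leave_round:
  assumes e: "achievable M l n (\<lambda>x S. a) e"
  shows "achievable M l n (\<lambda>x S. a) ((1 - \<delta>) ^ (n - l) * e + n * \<delta> * (1 - \<delta>) ^ n * v)"
proof -
  have "j \<le> n \<Longrightarrow> achievable M l n (\<lambda>x S. a * (1 - \<delta>) ^ card ({..<n - j} - S))
      ((1 - \<delta>) ^ (n - l) * e + j * (\<delta> * (1 - \<delta>) ^ n * v))" for j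
  proof (induction j)
    case 0
    have "achievable M l n (\<lambda>x S. (1 - \<delta>) ^ (n - l) * a) ((1 - \<delta>) ^ (n - l) * e)"
      using \<delta> by (intro achievable_scale e) auto
    then show ?case
    proof (rule achievable_mono)
      fix S assume "S \<in> knower_sets n l"
      then have "card ({..<n} - S) = n - l"
        by (subst card_Diff_subset) (auto simp: knower_sets_def intro: finite_subset)
      then show "(1 - \<delta>) ^ (n - l) * a \<le> a * (1 - \<delta>) ^ card ({..<n - 0} - S)" by simp
    qed simp
  next
    case (Suc j)
    then have "Suc (n - Suc j) = n - j" by simp
    with Suc have "achievable M l n (\<lambda>x S. a * (1 - \<delta>) ^ card ({..<n - Suc j} - S))
        ((1 - \<delta>) ^ (n - l) * e + j * (\<delta> * (1 - \<delta>) ^ n * v) + \<delta> * (1 - \<delta>) ^ n * v)"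
      by (intro achievable_leave_step) auto
    then show ?case by (simp add: algebra_simps)
  qed
  from this[of n] show ?thesis by (simp add: mult_ac)
qed

text \<open>Iterates the round, starting from value 0. Protocols have bounded length, so only
  partial sums of the geometric series appear; the limit is taken later, in the values
  alone.\<close>

lemma achievable_leave_rounds:
  "achievable M l n (\<lambda>x S. a) (\<Sum>r<R. ((1 - \<delta>) ^ (n - l)) ^ r * (n * \<delta> * (1 - \<delta>) ^ n * v))"
proof (induction R)
  case 0
  then show ?case using a by (auto intro: achievable_0)
next
  case (Suc R)
  let ?Q = "(1 - \<delta>) ^ (n - l)" and ?B = "n * \<delta> * (1 - \<delta>) ^ n * v"
  have "(\<Sum>r<Suc R. ?Q ^ r * ?B) = ?Q * (\<Sum>r<R. ?Q ^ r * ?B) + ?B"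
    by (simp only: sum.lessThan_Suc_shift) (simp add: sum_distrib_left mult.assoc)
  with achievable_leave_round[OF Suc.IH] show ?case by simp
qed

end

lemma Succ_n_nonneg: "0 < n \<Longrightarrow> l \<le> n \<Longrightarrow> 0 \<le> Succ_n h l n"
  by (rule le_Succ_n) (auto intro: achievable_0 prior_nonneg)

text \<open>A surplus player who does not know the secret can be removed at no cost: the players
  repeatedly speak in turn, non-knowers resigning with a small probability \<^term>\<open>\<delta>\<close>, until the first
  resignation. As \<^term>\<open>\<delta>\<close> tends to 0, the knowers become uniform among the remaining players.\<close>

lemma Succ_n_le_Suc:
  assumes n: "0 < n" "l \<le> n"
  shows "Succ_n h l n \<le> Succ_n h l (Suc n)"
proof (rule dense_le)
  fix c assume c: "c < Succ_n h l n"
  let ?N = "Suc n" and ?M = "num_secrets h"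
  show "c \<le> Succ_n h l ?N"
  proof (cases "c \<le> 0")
    case True
    then show ?thesis using Succ_n_nonneg[of ?N l h] n by simp
  next
    case False
    let ?a = "prior ?M l ?N"
    \<comment> \<open>\<open>\<theta>\<close> is the probability that a given player does not know
      the secret. Conditionally on this, the knowers are uniform among the other \<open>n\<close>
      players, which is what \<open>prior_eq\<close> expresses.\<close>
    define \<theta> where "\<theta> = (?N - l) / real ?N"
    have \<theta>: "0 < \<theta>" using n by (simp add: \<theta>_def)
    have "(?N - l) * (?N choose l) = ?N * (n choose l)"
      using n by (metis binomial_absorb_comp diff_Suc_1)
    then have abs: "real (?N - l) * real (?N choose l) = real ?N * real (n choose l)"
      by (simp only: of_nat_mult[symmetric])
    then have prior_eq: "\<theta> * prior ?M l n = ?a"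
    proof -
      have "u / N * (1 / (M * B)) = 1 / (M * A)"
        if "u * A = N * B" "0 < N" "0 < A" "0 < B" "0 < M" for u A N B M :: real
        using that by (simp add: field_simps)
      with abs show ?thesis using n by (simp add: \<theta>_def prior_def)
    qed
    have ach: "achievable ?M l ?N (\<lambda>x S. if i \<in> S then 0 else ?a) (\<theta> * c)" if "i < ?N" for i
    proof (rule achievable_skip[OF that n(1)])
      show "achievable ?M l n (\<lambda>x S. ?a) (\<theta> * c)"
        using achievable_scale[OF less_Succ_n_imp_achievable[OF n c], of \<theta>] \<theta> by (simp add: prior_eq)
    qed (simp add: prior_nonneg)
    \<comment> \<open>A resignation in mid-round leaves the knowers not exactly uniform. The power
      of \<open>1 - \<delta>\<close> bounds this loss and disappears in the limit.\<close>
    have "(1 - \<delta>) ^ ?N * c \<le> Succ_n h l ?N" if \<delta>: "0 < \<delta>" "\<delta> < 1" for \<delta> :: real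
    proof -
      let ?Q = "(1 - \<delta>) ^ (?N - l)" and ?B = "?N * \<delta> * (1 - \<delta>) ^ ?N * (\<theta> * c)"
      have Q: "0 \<le> ?Q" "?Q < 1"
        using \<delta> n by (auto intro!: power_Suc_less_one simp: power_less_one_iff)
      have "(\<Sum>r<R. ?Q ^ r * ?B) \<le> Succ_n h l ?N" for R
        using n False \<theta> \<delta> by (intro le_Succ_n achievable_leave_rounds ach) (auto simp: prior_nonneg)
      moreover have "(\<lambda>r. ?Q ^ r * ?B) sums (1 / (1 - ?Q) * ?B)"
        using Q by (intro sums_mult2 geometric_sums) auto
      ultimately have "1 / (1 - ?Q) * ?B \<le> Succ_n h l ?N"
        unfolding sums_def by (intro LIMSEQ_le_const2) auto
      \<comment> \<open>Bernoulli's inequality bounds \<open>1 - ?Q\<close> by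
        \<open>?N * \<delta> * \<theta>\<close>, which cancels against the same factor in the
        geometric sum.\<close>
      moreover have "(1 - \<delta>) ^ ?N * c \<le> 1 / (1 - ?Q) * ?B"
      proof -
        have "1 - ?Q \<le> (?N - l) * \<delta>"
          using Bernoulli_inequality[of "-\<delta>" "?N - l"] \<delta> by simp
        also have "\<dots> = ?N * \<delta> * \<theta>"
          by (simp add: \<theta>_def)
        finally have "(1 - ?Q) * ((1 - \<delta>) ^ ?N * c) \<le> ?N * \<delta> * \<theta> * ((1 - \<delta>) ^ ?N * c)"
          using False \<delta> by (intro mult_right_mono) auto
        then show ?thesis using Q by (simp add: field_simps)
      qed
      ultimately show ?thesis by linarith
    qed
    then have "\<forall>\<^sub>F \<delta> in at_right 0. (1 - \<delta>) ^ ?N * c \<le> Succ_n h l ?N"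
      unfolding eventually_at_right_field by (intro exI[of _ 1]) auto
    moreover have "((\<lambda>\<delta>. (1 - \<delta>) ^ ?N * c) \<longlongrightarrow> (1 - 0) ^ ?N * c) (at_right (0::real))"
      by (intro tendsto_intros)
    ultimately show ?thesis
      using tendsto_upperbound[of "\<lambda>\<delta>. (1 - \<delta>) ^ ?N * c" "(1 - 0) ^ ?N * c" "at_right (0::real)" "Succ_n h l ?N"]
      by simp
  qed
qed

lemma Succ_n_le_Succ:
  assumes "0 < n" "l \<le> n"
  shows "Succ_n h l n \<le> Succ h l"
proof -
  \<comment> \<open>The sequence is shifted because monotonicity is available only once
    \<open>0 < n\<close> and \<open>l \<le> n\<close>.\<close>
  let ?s = "\<lambda>k. Succ_n h l (k + n)"
  have inc: "incseq ?s"
    using assms by (intro incseq_SucI) (auto intro: Succ_n_le_Suc)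
  have "?s k \<le> 1" for k
    using assms by (intro Succ_n_le_1) auto
  then obtain L where L: "?s \<longlonglongrightarrow> L"
    using incseq_convergent[OF inc] by blast
  then have "Succ_n h l \<longlonglongrightarrow> L" by (rule LIMSEQ_offset)
  then have "Succ h l = L" unfolding Succ_def by (rule limI)
  moreover have "?s 0 \<le> L" using inc L by (rule incseq_le)
  ultimately show ?thesis by simp
qed

section \<open>Random codes\<close>

definition words :: "nat \<Rightarrow> nat \<Rightarrow> nat list set" where
  "words d n = {t. set t \<subseteq> {..<d} \<and> length t = n}"

lemma finite_words [simp]: "finite (words d n)"
  unfolding words_def by (rule finite_lists_length_eq) simp

lemma card_words: "card (words d n) = d ^ n"
  unfolding words_def by (simp add: card_lists_length_eq)

lemma words_0 [simp]: "words d 0 = {[]}"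
  by (auto simp: words_def)

lemma sum_words_Suc: "(\<Sum>t\<in>words d (Suc n). \<psi> t) = (\<Sum>m<d. \<Sum>u\<in>words d n. \<psi> (m # u))"
proof -
  have "(\<Sum>m<d. \<Sum>u\<in>words d n. \<psi> (m # u)) = (\<Sum>(m, u)\<in>{..<d} \<times> words d n. \<psi> (m # u))"
    by (simp add: sum.cartesian_product)
  also have "\<dots> = (\<Sum>t\<in>words d (Suc n). \<psi> t)"
    by (rule sum.reindex_bij_witness[of _ "\<lambda>t. (hd t, tl t)" "\<lambda>(m, u). m # u"])
      (auto simp: words_def length_Suc_conv)
  finally show ?thesis by simp
qed

definition agreements :: "'a list \<Rightarrow> 'a list \<Rightarrow> nat" where
  "agreements t u = length (filter (\<lambda>(a, b). a = b) (zip t u))"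

lemma agreements_simps [simp]:
  "agreements [] u = 0" "agreements (a # t) (b # u) = of_bool (a = b) + agreements t u"
  by (simp_all add: agreements_def)

lemma agreements_eq_card:
  "length t = length u \<Longrightarrow> agreements t u = card {i. i < length t \<and> t ! i = u ! i}"
  by (auto simp: agreements_def length_filter_conv_card intro!: arg_cong[of _ _ card])

lemma agreements_commute: "length t = length u \<Longrightarrow> agreements t u = agreements u t"
  by (auto simp: agreements_eq_card intro!: arg_cong[of _ _ card])

text \<open>Pascal's rule, arranged as a case split on the first letter: one of \<open>e\<close>
  differing letters, or the agreeing one.\<close>

lemma sum_binomial_Suc:
  fixes e :: real and \<psi> :: "nat \<Rightarrow> real"
  shows "(\<Sum>a\<le>Suc n. real (Suc n choose a) * e ^ (Suc n - a) * \<psi> a) =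
    e * (\<Sum>a\<le>n. real (n choose a) * e ^ (n - a) * \<psi> a) +
    (\<Sum>a\<le>n. real (n choose a) * e ^ (n - a) * \<psi> (Suc a))"
proof -
  have "e * (\<Sum>a\<le>n. real (n choose a) * e ^ (n - a) * \<psi> a)
      = (\<Sum>a\<le>n. real (n choose a) * e ^ (Suc n - a) * \<psi> a)"
    by (auto simp: sum_distrib_left Suc_diff_le intro!: sum.cong)
  also have "\<dots> = (\<Sum>a\<le>Suc n. real (n choose a) * e ^ (Suc n - a) * \<psi> a)"
    by simp
  also have "\<dots> = e ^ Suc n * \<psi> 0 + (\<Sum>a\<le>n. real (n choose Suc a) * e ^ (n - a) * \<psi> (Suc a))"
    by (simp only: sum.atMost_Suc_shift) simp
  finally have *: "e * (\<Sum>a\<le>n. real (n choose a) * e ^ (n - a) * \<psi> a)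
      = e ^ Suc n * \<psi> 0 + (\<Sum>a\<le>n. real (n choose Suc a) * e ^ (n - a) * \<psi> (Suc a))" .
  show ?thesis
    unfolding * by (simp only: sum.atMost_Suc_shift) (simp add: sum.distrib algebra_simps)
qed

text \<open>Splitting off the first letter counts the words with \<open>a\<close> agreements as in
  the binomial theorem, for every \<open>t\<close> alike. This gives the equal row sums that
  \<open>exists_code\<close> asks for.\<close>

lemma sum_words_agreements:
  assumes "t \<in> words d n"
  shows "(\<Sum>u\<in>words d n. \<psi> (agreements t u))
    = (\<Sum>a\<le>n. real (n choose a) * (real d - 1) ^ (n - a) * \<psi> a)"
  using assms
proof (induction n arbitrary: t \<psi>)
  case 0
  then show ?case by simp
next
  case (Suc n)
  then obtain b t' where t: "t = b # t'" "b < d" "t' \<in> words d n"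
    by (auto simp: words_def length_Suc_conv)
  let ?Z = "\<lambda>\<phi>. \<Sum>a\<le>n. real (n choose a) * (real d - 1) ^ (n - a) * \<phi> a"
  have "(\<Sum>u\<in>words d (Suc n). \<psi> (agreements t u))
      = (\<Sum>m<d. \<Sum>u\<in>words d n. \<psi> (of_bool (b = m) + agreements t' u))"
    by (simp add: sum_words_Suc t)
  also have "\<dots> = (\<Sum>m<d. if m = b then ?Z (\<lambda>a. \<psi> (Suc a)) else ?Z \<psi>)"
    using Suc.IH[OF t(3), of \<psi>] Suc.IH[OF t(3), of "\<lambda>a. \<psi> (Suc a)"] by (auto intro!: sum.cong)
  also have "\<dots> = ?Z (\<lambda>a. \<psi> (Suc a)) + (\<Sum>m\<in>{..<d} - {b}. ?Z \<psi>)"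
    using t(2) by (subst sum.remove[of _ b]) auto
  also have "\<dots> = ?Z (\<lambda>a. \<psi> (Suc a)) + (real d - 1) * ?Z \<psi>"
    using t(2) by (simp add: of_nat_diff)
  finally show ?case by (simp only: sum_binomial_Suc)
qed

section \<open>Choosing a code by averaging\<close>

lemma exists_ge_average:
  fixes f :: "'a \<Rightarrow> real" and a :: real
  assumes "finite W" "W \<noteq> {}" "(\<Sum>u\<in>W. f u) = card W * a"
  shows "\<exists>u\<in>W. a \<le> f u"
proof (rule ccontr)
  assume "\<not> ?thesis"
  then have "(\<Sum>u\<in>W. f u) < (\<Sum>u\<in>W. a)"
    using assms by (intro sum_strict_mono) auto
  with assms(3) show False by simp
qed

text \<open>The codewords are chosen one after the other, each at least as good as an average choice.\<close>

lemma exists_code: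
  fixes G H :: "'a \<Rightarrow> 'a \<Rightarrow> real"
  assumes fin: "finite W" and ne: "W \<noteq> {}"
    and G_row: "\<And>t. t \<in> W \<Longrightarrow> (\<Sum>u\<in>W. G t u) = \<gamma>"
    and H_row: "\<And>t. t \<in> W \<Longrightarrow> (\<Sum>u\<in>W. H t u) = \<eta>"
    and sym: "\<And>t u. t \<in> W \<Longrightarrow> u \<in> W \<Longrightarrow> G t u = G u t \<and> H t u = H u t"
  shows "\<exists>c. (\<forall>y. c y \<in> W) \<and> (\<Sum>t\<in>W. \<Sum>y\<in>{1..M}. G t (c y) * (1 - (\<Sum>z\<in>{1..M}-{y}. H t (c z))))
     \<ge> real M * \<gamma> - real M * (real M - 1) * (\<gamma> * \<eta> / card W)"
proof (induction M)
  case 0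
  then show ?case using ne by auto
next
  case (Suc M)
  then obtain c where c: "\<And>y. c y \<in> W" and
    IH: "(\<Sum>t\<in>W. \<Sum>y\<in>{1..M}. G t (c y) * (1 - (\<Sum>z\<in>{1..M}-{y}. H t (c z))))
     \<ge> real M * \<gamma> - real M * (real M - 1) * (\<gamma> * \<eta> / card W)" by blast
  have G_col: "(\<Sum>t\<in>W. G t u) = \<gamma>" if "u \<in> W" for u
    using G_row[OF that] sym that by (metis (no_types, lifting) sum.cong)
  have H_col: "(\<Sum>t\<in>W. H t u) = \<eta>" if "u \<in> W" for u
    using H_row[OF that] sym that by (metis (no_types, lifting) sum.cong)
  have card: "0 < real (card W)" using fin ne by (simp add: card_gt_0_iff)
  \<comment> \<open>\<open>f u\<close> is the change of the objective when \<open>u\<close> becomes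
    a codeword: its own score, minus what it takes from the old codewords, minus what they take from
    it.\<close>
  define f where "f u = (\<Sum>t\<in>W. G t u - (\<Sum>y\<in>{1..M}. G t (c y) * H t u) - (\<Sum>y\<in>{1..M}. G t u * H t (c y)))" for u
  have "(\<Sum>u\<in>W. f u) = (\<Sum>t\<in>W. (\<Sum>u\<in>W. G t u) - (\<Sum>y\<in>{1..M}. G t (c y)) * (\<Sum>u\<in>W. H t u)
      - (\<Sum>u\<in>W. G t u) * (\<Sum>y\<in>{1..M}. H t (c y)))"
    unfolding f_def
    by (subst sum.swap) (simp add: sum_subtractf sum_distrib_left[symmetric] sum_distrib_right[symmetric])
  also have "\<dots> = (\<Sum>t\<in>W. \<gamma> - (\<Sum>y\<in>{1..M}. G t (c y)) * \<eta> - \<gamma> * (\<Sum>y\<in>{1..M}. H t (c y)))"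
    by (intro sum.cong) (auto simp: G_row H_row)
  also have "\<dots> = card W * \<gamma> - (\<Sum>y\<in>{1..M}. \<Sum>t\<in>W. G t (c y)) * \<eta> - \<gamma> * (\<Sum>y\<in>{1..M}. \<Sum>t\<in>W. H t (c y))"
    by (simp add: sum_subtractf sum_distrib_left[symmetric] sum_distrib_right[symmetric] sum.swap[of _ W])
  \<comment> \<open>Each old codeword causes the penalty \<open>\<gamma> * \<eta>\<close> twice,
    once in each role of a pair.\<close>
  also have "\<dots> = card W * (\<gamma> - 2 * M * (\<gamma> * \<eta> / card W))"
    using card by (simp add: G_col[OF c] H_col[OF c] field_simps)
  finally obtain u where u: "u \<in> W" and fu: "\<gamma> - 2 * M * (\<gamma> * \<eta> / card W) \<le> f u"
    using exists_ge_average[OF fin ne] by blast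
  let ?c = "c(Suc M := u)"
  have "(\<Sum>t\<in>W. \<Sum>y\<in>{1..Suc M}. G t (?c y) * (1 - (\<Sum>z\<in>{1..Suc M}-{y}. H t (?c z))))
      = (\<Sum>t\<in>W. \<Sum>y\<in>{1..M}. G t (c y) * (1 - (\<Sum>z\<in>{1..M}-{y}. H t (c z)))) + f u"
    unfolding f_def sum.distrib[symmetric]
  proof (rule sum.cong)
    fix t
    have "(\<Sum>z\<in>{1..Suc M}-{y}. H t (?c z)) = (\<Sum>z\<in>{1..M}-{y}. H t (c z)) + H t u" if "y \<in> {1..M}" for y
    proof -
      have "{1..Suc M} - {y} = insert (Suc M) ({1..M} - {y})" using that by auto
      then show ?thesis by simp
    qed
    then have 1: "(\<Sum>y\<in>{1..M}. G t (?c y) * (1 - (\<Sum>z\<in>{1..Suc M}-{y}. H t (?c z))))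
        = (\<Sum>y\<in>{1..M}. G t (c y) * (1 - ((\<Sum>z\<in>{1..M}-{y}. H t (c z)) + H t u)))"
      by (intro sum.cong refl) auto
    have "{1..Suc M} - {Suc M} = {1..M}" by auto
    then have 2: "(\<Sum>z\<in>{1..Suc M}-{Suc M}. H t (?c z)) = (\<Sum>z\<in>{1..M}. H t (c z))"
      by (simp only:) (auto intro!: sum.cong)
    have "(\<Sum>y\<in>{1..Suc M}. G t (?c y) * (1 - (\<Sum>z\<in>{1..Suc M}-{y}. H t (?c z))))
      = (\<Sum>y\<in>{1..M}. G t (?c y) * (1 - (\<Sum>z\<in>{1..Suc M}-{y}. H t (?c z))))
        + G t u * (1 - (\<Sum>z\<in>{1..Suc M}-{Suc M}. H t (?c z)))"
      by (subst sum.cl_ivl_Suc) simp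
    then show "(\<Sum>y\<in>{1..Suc M}. G t (?c y) * (1 - (\<Sum>z\<in>{1..Suc M}-{y}. H t (?c z))))
      = (\<Sum>y\<in>{1..M}. G t (c y) * (1 - (\<Sum>z\<in>{1..M}-{y}. H t (c z))))
        + (G t u - (\<Sum>y\<in>{1..M}. G t (c y) * H t u) - (\<Sum>y\<in>{1..M}. G t u * H t (c y)))"
      unfolding 1 2 by (simp add: algebra_simps sum.distrib sum_subtractf sum_distrib_left)
  qed simp
  \<comment> \<open>The bounds telescope, since (M + 1) M - M (M - 1) = 2 M.\<close>
  also have "\<dots> \<ge> real (Suc M) * \<gamma> - real (Suc M) * (real (Suc M) - 1) * (\<gamma> * \<eta> / card W)"
  proof -
    have "real (Suc M) * \<gamma> - real (Suc M) * (real (Suc M) - 1) * q \<le> T + F"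
      if "real M * \<gamma> - real M * (real M - 1) * q \<le> T" "\<gamma> - 2 * M * q \<le> F" for q T F :: real
      using that by (simp add: algebra_simps)
    from this[OF IH fu] show ?thesis .
  qed
  finally show ?case using c u by (intro exI[of _ ?c]) auto
qed

section \<open>Protocols built from a code\<close>

context
  fixes M l n d :: nat and a :: real and c :: "nat \<Rightarrow> nat list"
  assumes a: "0 \<le> a" and d: "0 < d" and c: "\<And>x. c x \<in> words d n"
begin

text \<open>The weight \<open>a\<close> times the likelihood of the partial transcript
  \<open>t\<close>, player \<open>i\<close> sending its letter \<open>i\<close>.\<close>

definition word_weight :: "nat list \<Rightarrow> nat \<Rightarrow> nat set \<Rightarrow> real" where
  "word_weight t x S = a * (\<Prod>i<length t. if i \<in> S then of_bool (t ! i = c x ! i) else 1 / d)"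

text \<open>Backward induction over the players still to speak. As the weights are unnormalised, the
  values at the complete transcripts simply add up.\<close>

lemma achievable_words:
  assumes "\<And>t. t \<in> words d n \<Longrightarrow> achievable M l n (word_weight t) (L t)"
    and "k + r = n" "t \<in> words d k"
  shows "achievable M l n (word_weight t) (\<Sum>u\<in>words d r. L (t @ u))"
  using assms(2,3)
proof (induction r arbitrary: k t)
  case 0
  then show ?case using assms(1) by simp
next
  case (Suc r)
  have t: "length t = k" using Suc.prems by (simp add: words_def)
  have "achievable M l n (word_weight t) (\<Sum>m\<in>{..<d}. \<Sum>u\<in>words d r. L (t @ m # u))"
  proof (rule achievable_split[where i = k and pu = "pmf_of_set {..<d}" and pk = "\<lambda>x. return_pmf (c x ! k)"])
    show "set_pmf (return_pmf (c x ! k)) \<subseteq> {..<d}" for x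
    proof -
      have "k < length (c x)" "set (c x) \<subseteq> {..<d}"
        using c[of x] Suc.prems(1) by (auto simp: words_def)
      then show ?thesis using nth_mem[of k "c x"] by (auto simp del: nth_mem)
    qed
    show "set_pmf (pmf_of_set {..<d}) \<subseteq> {..<d}"
      using d by (subst set_pmf_of_set) auto
    fix m assume m: "m \<in> {..<d}"
    have "t @ [m] \<in> words d (Suc k)" using Suc.prems m by (auto simp: words_def)
    then have "achievable M l n (word_weight (t @ [m])) (\<Sum>u\<in>words d r. L ((t @ [m]) @ u))"
      using Suc.prems by (intro Suc.IH) auto
    then show "achievable M l n (\<lambda>x S. word_weight t x S *
        pmf (if k \<in> S then return_pmf (c x ! k) else pmf_of_set {..<d}) m) (\<Sum>u\<in>words d r. L (t @ m # u))"
    proof (rule achievable_mono)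
      fix x S
      have "(\<Prod>i<k. if i \<in> S then of_bool ((t @ [m]) ! i = c x ! i) else 1 / d)
          = (\<Prod>i<k. if i \<in> S then of_bool (t ! i = c x ! i) else 1 / d :: real)"
        by (intro prod.cong) (auto simp: nth_append t)
      moreover have "pmf (if k \<in> S then return_pmf (c x ! k) else pmf_of_set {..<d}) m
          = (if k \<in> S then of_bool (m = c x ! k) else 1 / d)"
        using m by (subst if_distrib[of "\<lambda>p. pmf p m"], subst pmf_of_set) (auto simp: indicator_def lessThan_empty_iff)
      ultimately show "word_weight (t @ [m]) x S \<le> word_weight t x S *
          pmf (if k \<in> S then return_pmf (c x ! k) else pmf_of_set {..<d}) m"
        using t by (simp add: word_weight_def nth_append)
    qed simp
  qed (use Suc.prems in auto)
  then show ?case by (simp add: sum_words_Suc)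
qed

text \<open>The non-knowers contribute the same factor for every \<open>S\<close>, so given
  \<open>t\<close> and \<open>x\<close> the knowers are uniform among the \<open>l\<close>-subsets
  of the agreeing players.\<close>

lemma word_weight_eq:
  assumes t: "t \<in> words d n" and S: "S \<in> knower_sets n l"
  shows "word_weight t x S = a * (1 / d) ^ (n - l) * of_bool (S \<subseteq> {i. i < n \<and> t ! i = c x ! i})"
proof -
  have S': "S \<subseteq> {..<n}" "card S = l" "finite S"
    using S by (auto simp: knower_sets_def intro: finite_subset)
  then have "{..<n} \<inter> {i. i \<in> S} = S" "{..<n} \<inter> - {i. i \<in> S} = {..<n} - S" by auto
  then have "(\<Prod>i<n. if i \<in> S then of_bool (t ! i = c x ! i) else 1 / d :: real)
      = (\<Prod>i\<in>S. of_bool (t ! i = c x ! i)) * (1 / d) ^ (n - l)"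
    using S' by (simp add: prod.If_cases card_Diff_subset)
  moreover have "(\<Prod>i\<in>S. of_bool (t ! i = c x ! i) :: real) = of_bool (S \<subseteq> {i. i < n \<and> t ! i = c x ! i})"
    using S' by (cases "\<forall>i\<in>S. t ! i = c x ! i") (auto simp: prod_zero_iff)
  moreover have "length t = n" using t by (simp add: words_def)
  ultimately show ?thesis by (simp add: word_weight_def)
qed

text \<open>If Frank guesses \<open>y\<close>, the surviving weight counts the
  \<open>l\<close>-subsets of the agreeing players that avoid the player named by Eve. Her naming an
  agreeing player is the worst case and leaves one candidate fewer.\<close>

lemma achievable_word_leaf:
  assumes t: "t \<in> words d n" and y: "y \<in> {1..M}"
  shows "achievable M l n (word_weight t) (a * (1 / d) ^ (n - l) * real (agreements t (c y) - 1 choose l))"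
proof (rule achievable_leaf[OF _ y])
  fix i
  let ?A = "{i. i < n \<and> t ! i = c y ! i}"
  have "card ?A = agreements t (c y)"
    using t c[of y] by (subst agreements_eq_card) (auto simp: words_def)
  then have "agreements t (c y) - 1 \<le> card (?A - {i})"
    using diff_card_le_card_Diff[of "{i}" ?A] by simp
  then have "real (agreements t (c y) - 1 choose l) \<le> real (card (?A - {i}) choose l)"
    by (intro of_nat_mono binomial_right_mono)
  also have "card (?A - {i}) choose l = card {S. S \<subseteq> ?A - {i} \<and> card S = l}"
    by (rule n_subsets[symmetric]) simp
  also have "{S. S \<subseteq> ?A - {i} \<and> card S = l} = {S \<in> {S \<in> knower_sets n l. i \<notin> S}. S \<subseteq> ?A}"
    by (auto simp: knower_sets_def)
  finally have "a * (1 / d) ^ (n - l) * real (agreements t (c y) - 1 choose l)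
      \<le> a * (1 / d) ^ (n - l) * card {S \<in> {S \<in> knower_sets n l. i \<notin> S}. S \<subseteq> ?A}"
    using a by (intro mult_left_mono) auto
  also have "\<dots> = (\<Sum>S\<in>{S \<in> knower_sets n l. i \<notin> S}. a * (1 / d) ^ (n - l) * of_bool (S \<subseteq> ?A))"
    by (simp add: sum_distrib_left[symmetric] sum.If_cases of_bool_def Int_def)
  also have "\<dots> = (\<Sum>S\<in>{S \<in> knower_sets n l. i \<notin> S}. word_weight t y S)"
    by (intro sum.cong) (auto simp: word_weight_eq[OF t])
  finally show "a * (1 / d) ^ (n - l) * real (agreements t (c y) - 1 choose l)
     \<le> (\<Sum>S\<in>{S \<in> knower_sets n l. i \<notin> S}. word_weight t y S)" .
qed (use a in \<open>auto simp: word_weight_def intro!: mult_nonneg_nonneg prod_nonneg\<close>)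

text \<open>\<open>P\<close> is Frank's test on the number of agreements. If exactly one codeword
  passes, the sum over \<open>y\<close> is its score, achieved by guessing it; otherwise the sum is
  at most 0. The bound involves only pairs of codewords, so it can be averaged.\<close>

lemma achievable_code:
  fixes P :: "nat \<Rightarrow> bool"
  defines "G \<equiv> \<lambda>k. a * (1 / d) ^ (n - l) * real (k - 1 choose l) * of_bool (P k)"
    and "H \<equiv> \<lambda>k. of_bool (P k) :: real"
  shows "achievable M l n (\<lambda>_ _. a) (\<Sum>t\<in>words d n. \<Sum>y\<in>{1..M}.
    G (agreements t (c y)) * (1 - (\<Sum>z\<in>{1..M}-{y}. H (agreements t (c z)))))"
proof -
  let ?L = "\<lambda>t. \<Sum>y\<in>{1..M}. G (agreements t (c y)) * (1 - (\<Sum>z\<in>{1..M}-{y}. H (agreements t (c z))))"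
  have "achievable M l n (word_weight t) (?L t)" if t: "t \<in> words d n" for t
  proof -
    define Y where "Y = {y \<in> {1..M}. P (agreements t (c y))}"
    have G0: "0 \<le> G k" for k using a by (simp add: G_def)
    have H: "(\<Sum>z\<in>{1..M}-{y}. H (agreements t (c z))) = card (Y - {y})" for y
    proof -
      have "({1..M} - {y}) \<inter> {z. P (agreements t (c z))} = Y - {y}" by (auto simp: Y_def)
      then show ?thesis by (simp add: H_def of_bool_def sum.If_cases)
    qed
    have L: "?L t = (\<Sum>y\<in>Y. G (agreements t (c y)) * (1 - real (card (Y - {y}))))"
      unfolding H by (rule sum.mono_neutral_right) (auto simp: Y_def G_def)
    show ?thesis
    proof (cases "\<exists>y. Y = {y}")
      case True
      then obtain y where y: "Y = {y}" by blast
      then have "P (agreements t (c y))" "y \<in> {1..M}" by (auto simp: Y_def)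
      then show ?thesis
        using achievable_word_leaf[OF t, of y] unfolding L y by (simp add: G_def)
    next
      case False
      \<comment> \<open>This covers both an empty \<open>Y\<close> and several passing codewords,
        each of which then has a competitor.\<close>
      have "?L t \<le> 0" unfolding L
      proof (rule sum_nonpos)
        fix y assume "y \<in> Y"
        with False have "Y - {y} \<noteq> {}" by blast
        then have "1 \<le> card (Y - {y})" by (simp add: Suc_le_eq card_gt_0_iff Y_def)
        then show "G (agreements t (c y)) * (1 - real (card (Y - {y}))) \<le> 0"
          using G0 by (intro mult_nonneg_nonpos) auto
      qed
      then show ?thesis
        using a by (intro achievable_mono[OF achievable_0[of M n l "word_weight t"]])
          (auto simp: word_weight_def intro!: mult_nonneg_nonneg prod_nonneg)
    qed
  qed
  then have "achievable M l n (word_weight []) (\<Sum>t\<in>words d n. ?L ([] @ t))"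
    by (intro achievable_words[where k = 0]) auto
  moreover have "word_weight [] = (\<lambda>_ _. a)" by (simp add: word_weight_def fun_eq_iff)
  ultimately show ?thesis by simp
qed

end

text \<open>\<open>\<gamma>\<close> and \<open>\<eta>\<close> are the row sums of score and test
  over all words, and \<open>real d ^ n\<close> is the number of words.\<close>

lemma achievable_random_code:
  fixes P :: "nat \<Rightarrow> bool" and a :: real and n l d M :: nat
  assumes "0 \<le> a" "0 < d"
  defines "\<gamma> \<equiv> \<Sum>k\<le>n. real (n choose k) * (real d - 1) ^ (n - k) *
      (a * (1 / d) ^ (n - l) * real (k - 1 choose l) * of_bool (P k))"
    and "\<eta> \<equiv> \<Sum>k\<le>n. real (n choose k) * (real d - 1) ^ (n - k) * of_bool (P k)"
  shows "achievable M l n (\<lambda>_ _. a) (real M * \<gamma> - real M * (real M - 1) * (\<gamma> * \<eta> / real d ^ n))"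
proof -
  have ne: "words d n \<noteq> {}"
    using card_words[of d n] assms(2) by fastforce
  let ?G = "\<lambda>t u. a * (1 / d) ^ (n - l) * real (agreements t u - 1 choose l) * of_bool (P (agreements t u))"
  let ?H = "\<lambda>t u. of_bool (P (agreements t u)) :: real"
  have "\<exists>c. (\<forall>y. c y \<in> words d n) \<and>
      (\<Sum>t\<in>words d n. \<Sum>y\<in>{1..M}. ?G t (c y) * (1 - (\<Sum>z\<in>{1..M}-{y}. ?H t (c z))))
     \<ge> real M * \<gamma> - real M * (real M - 1) * (\<gamma> * \<eta> / card (words d n))"
  proof (rule exists_code[OF finite_words ne])
    show "(\<Sum>u\<in>words d n. ?G t u) = \<gamma>" if "t \<in> words d n" for t
      unfolding \<gamma>_def by (rule sum_words_agreements[OF that])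
    show "(\<Sum>u\<in>words d n. ?H t u) = \<eta>" if "t \<in> words d n" for t
      unfolding \<eta>_def by (rule sum_words_agreements[OF that])
    fix t u assume "t \<in> words d n" "u \<in> words d n"
    then have "agreements t u = agreements u t"
      by (intro agreements_commute) (simp add: words_def)
    then show "?G t u = ?G u t \<and> ?H t u = ?H u t" by simp
  qed
  then obtain c where "\<And>y. c y \<in> words d n" and
    "(\<Sum>t\<in>words d n. \<Sum>y\<in>{1..M}. ?G t (c y) * (1 - (\<Sum>z\<in>{1..M}-{y}. ?H t (c z))))
     \<ge> real M * \<gamma> - real M * (real M - 1) * (\<gamma> * \<eta> / card (words d n))" by blast
  then show ?thesis
    using achievable_code[OF assms(1,2), of c n M l P] by (auto simp: card_words elim: achievable_mono)
qed

text \<open>Choosing the agreeing players and then the knowers among them amounts to choosing the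
  knowers first and the other agreeing players afterwards. The fraction is the chance that a fixed
  agreeing player is not a knower.\<close>

lemma choose_mult_pred:
  assumes "l \<le> k" "k \<le> n" "0 < k"
  shows "real (n choose k) * real (k - 1 choose l)
    = real (n choose l) * (real (n - l choose (k - l)) * (real (k - l) / real k))"
proof -
  have "(k - l) * (k choose l) = k * (k - 1 choose l)"
    using assms by (metis binomial_absorb_comp)
  then have "real (k - 1 choose l) = real (k - l) / real k * real (k choose l)"
    using assms(3) by (simp add: field_simps del: of_nat_diff flip: of_nat_mult)
  moreover have "real (n choose k) * real (k choose l) = real (n choose l) * real (n - l choose (k - l))"
    using choose_mult[OF assms(1,2)] by (metis of_nat_mult)
  ultimately show ?thesis by (simp add: mult_ac)
qed

text \<open>\<open>\<mu>\<close> averages, over the number \<open>b\<close> of non-knowers that happen to agree with the codeword of the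
  secret, the probability \<open>b / (l + b)\<close> that a given agreeing player is not a knower.\<close>

lemma Succ_n_ge_random_code:
  fixes P :: "nat \<Rightarrow> bool" and l m d :: nat
  assumes "0 < d" "0 < l"
  defines "\<mu> \<equiv> \<Sum>b\<le>m. real (m choose b) * (real d - 1) ^ (m - b) * (b / (l + b)) * of_bool (P (l + b)) / real d ^ m"
    and "\<eta> \<equiv> \<Sum>k\<le>l + m. real (l + m choose k) * (real d - 1) ^ (l + m - k) * of_bool (P k) / real d ^ (l + m)"
  shows "\<mu> * (1 - real (num_secrets h) * \<eta>) \<le> Succ_n h l (l + m)"
proof -
  let ?M = "num_secrets h" and ?n = "l + m"
  let ?a = "prior ?M l ?n"
  let ?f = "\<lambda>k. real (?n choose k) * (real d - 1) ^ (?n - k) *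
      (?a * (1 / d) ^ (?n - l) * real (k - 1 choose l) * of_bool (P k))"
  \<comment> \<open>For \<open>k < l\<close> also \<open>k - 1 < l\<close>, even at
    \<open>k = 0\<close> because \<open>0 < l\<close>, so these summands vanish. The index then
    becomes \<open>l + b\<close>, with \<open>b\<close> agreeing non-knowers.\<close>
  have "(\<Sum>k\<le>?n. ?f k) = (\<Sum>k\<in>{l..?n}. ?f k)"
    using assms by (intro sum.mono_neutral_right) (auto simp: binomial_eq_0)
  also have "\<dots> = (\<Sum>b\<in>{0..m}. ?f (l + b))"
    using sum.shift_bounds_cl_nat_ivl[of ?f 0 l m] by (simp add: add.commute)
  also have "\<dots> = (\<Sum>b\<le>m. real (m choose b) * (real d - 1) ^ (m - b) * (b / (l + b)) * of_bool (P (l + b)) / real d ^ m / real ?M)"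
  proof (intro sum.cong)
    fix b assume b: "b \<in> {..m}"
    have "0 < real (?n choose l)" by simp
    then have key: "?a * real (?n choose (l + b)) * real (l + b - 1 choose l) = real (m choose b) * (b / (l + b)) / real ?M"
      unfolding mult.assoc prior_def using b assms(2)
      by (subst choose_mult_pred) (auto simp: field_simps)
    have "?f (l + b) = (?a * real (?n choose (l + b)) * real (l + b - 1 choose l)) *
        ((real d - 1) ^ (m - b) * (1 / d) ^ m * of_bool (P (l + b)))"
      by (simp add: mult_ac)
    then show "?f (l + b) = real (m choose b) * (real d - 1) ^ (m - b) * (b / (l + b)) * of_bool (P (l + b)) / real d ^ m / real ?M"
      unfolding key by (simp add: power_one_over field_simps)
  qed auto
  also have "\<dots> = \<mu> / real ?M"
    unfolding \<mu>_def by (rule sum_divide_distrib[symmetric])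
  finally have \<mu>: "\<mu> = real ?M * (\<Sum>k\<le>?n. ?f k)" by simp
  have \<mu>_nonneg: "0 \<le> \<mu>" and \<eta>_nonneg: "0 \<le> \<eta>"
    using assms(1) by (auto simp: \<mu>_def \<eta>_def intro!: sum_nonneg divide_nonneg_nonneg mult_nonneg_nonneg)
  have "achievable ?M l ?n (\<lambda>_ _. ?a) (\<mu> - (real ?M - 1) * (\<mu> * \<eta>))"
  proof -
    define s where "s = (\<Sum>k\<le>?n. ?f k)"
    define e where "e = (\<Sum>k\<le>?n. real (?n choose k) * (real d - 1) ^ (?n - k) * of_bool (P k))"
    have "\<eta> = e / real d ^ ?n" "\<mu> = real ?M * s"
      by (simp_all only: \<eta>_def e_def \<mu> s_def sum_divide_distrib)
    then have "\<mu> - (real ?M - 1) * (\<mu> * \<eta>) = real ?M * s - real ?M * (real ?M - 1) * (s * e / real d ^ ?n)"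
      by (simp only: times_divide_eq_right mult_ac)
    then show ?thesis
      unfolding s_def e_def by (simp only:) (rule achievable_random_code[OF prior_nonneg assms(1)])
  qed
  then have "\<mu> - (real ?M - 1) * (\<mu> * \<eta>) \<le> Succ_n h l ?n"
    using assms(2) by (intro le_Succ_n) auto
  \<comment> \<open>Counting all secrets as competitors, instead of all but one, only weakens the
    bound.\<close>
  moreover have "0 \<le> \<mu> * \<eta>" using \<mu>_nonneg \<eta>_nonneg by simp
  ultimately show ?thesis by (simp add: algebra_simps)
qed

section \<open>Asymptotics\<close>

text \<open>Markov's inequality for s^K, where K is binomial with success probability 1/d, together
  with 1 + u \<le> exp u. Stating the hypothesis through \<open>ln s\<close> serves both tails: the
  upper one for s > 1, the lower one for s < 1.\<close>

lemma chernoff_binomial: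
  fixes s x :: real and d n :: nat
  assumes "0 < d" "0 < s" and P: "\<And>k. P k \<Longrightarrow> x * ln s \<le> real k * ln s"
  shows "(\<Sum>k\<le>n. real (n choose k) * (real d - 1) ^ (n - k) * of_bool (P k) / real d ^ n)
    \<le> exp (real n * (s - 1) / d - x * ln s)"
proof -
  have d: "0 \<le> real d - 1" using assms(1) by simp
  have "of_bool (P k) \<le> s ^ k * exp (- (x * ln s))" for k
  proof (cases "P k")
    case True
    then have "1 \<le> exp (real k * ln s - x * ln s)" using P[of k] by simp
    also have "\<dots> = s ^ k * exp (- (x * ln s))"
      using assms(2) by (simp add: exp_diff exp_minus exp_of_nat_mult divide_inverse)
    finally show ?thesis using True by simp
  qed (use assms(2) in simp)
  then have "(\<Sum>k\<le>n. real (n choose k) * (real d - 1) ^ (n - k) * of_bool (P k) / real d ^ n)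
    \<le> (\<Sum>k\<le>n. real (n choose k) * (real d - 1) ^ (n - k) * (s ^ k * exp (- (x * ln s))) / real d ^ n)"
    using d by (intro sum_mono divide_right_mono mult_left_mono) auto
  also have "\<dots> = ((s + (real d - 1)) / d) ^ n * exp (- (x * ln s))"
    unfolding power_divide binomial_ring sum_divide_distrib sum_distrib_right
    by (intro sum.cong) auto
  also have "(s + (real d - 1)) / d = 1 + (s - 1) / d"
    using assms(1) by (simp add: field_simps)
  also have "(1 + (s - 1) / d) ^ n \<le> exp ((s - 1) / d) ^ n"
  proof (rule power_mono)
    have "0 \<le> (s + (real d - 1)) / d" using assms(2) d by simp
    also have "\<dots> = 1 + (s - 1) / d" using assms(1) by (simp add: field_simps)
    finally show "0 \<le> 1 + (s - 1) / d" .
  qed (rule exp_ge_add_one_self)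
  also have "exp ((s - 1) / d) ^ n = exp (real n * (s - 1) / d)"
    by (simp flip: exp_of_nat_mult)
  finally show ?thesis by (simp add: exp_diff exp_minus divide_inverse)
qed

lemma binomial_weights_sum:
  fixes d n :: nat
  assumes "0 < d"
  shows "(\<Sum>k\<le>n. real (n choose k) * (real d - 1) ^ (n - k) / real d ^ n) = 1"
proof -
  have "(\<Sum>k\<le>n. real (n choose k) * (real d - 1) ^ (n - k)) = real d ^ n"
    using binomial_ring[of 1 "real d - 1" n] by simp
  then show ?thesis using assms by (simp add: sum_divide_distrib[symmetric])
qed

text \<open>The derivative is negative by the strict inequality ln u < u - 1 at u = 1/x. This makes
  the rate at \<open>q\<close> strictly larger than the one at \<open>p\<close>.\<close>

lemma rate_strict_antimono:
  fixes p q :: real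
  assumes "0 < q" "q < p" "p < 1"
  shows "- ln p / (1 - p) < - ln q / (1 - q)"
proof (rule DERIV_neg_imp_decreasing[OF assms(2)])
  fix x assume x: "q \<le> x" "x \<le> p"
  have 0: "0 < x" "x < 1" using x assms by auto
  have "((\<lambda>x. - ln x / (1 - x)) has_real_derivative (- (1 / x) * (1 - x) - (- ln x) * (- 1)) / ((1 - x) * (1 - x))) (at x)"
    using 0 by (auto intro!: derivative_eq_intros simp: add_divide_distrib diff_divide_distrib)
  moreover have "ln (1 / x) < 1 / x - 1"
    using 0 ln_eq_minus_one[of "1 / x"] ln_le_minus_one[of "1 / x"] by force
  then have "- (1 / x) * (1 - x) - (- ln x) * (- 1) < 0"
    using 0 by (simp add: ln_div field_simps)
  then have "(- (1 / x) * (1 - x) - (- ln x) * (- 1)) / ((1 - x) * (1 - x)) < 0"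
    using 0 by (intro divide_neg_pos) auto
  ultimately show "\<exists>y. ((\<lambda>x. - ln x / (1 - x)) has_real_derivative y) (at x) \<and> y < 0"
    by blast
qed

text \<open>With \<beta> = q / (1 - q), the threshold means b \<ge> \<beta> l, and then b / (l + b)
  \<ge> q. Since b is binomial with mean m / d \<ge> \<rho> l > \<beta> l, missing the threshold is
  a lower-tail event.\<close>

lemma random_code_gain_lower_bound:
  fixes q \<rho> :: real and d l m :: nat
  assumes q: "0 < q" "q < 1" and \<rho>: "q / (1 - q) < \<rho>" and d: "0 < d" and l: "0 < l"
    and m: "\<rho> * l * d \<le> m"
  shows "(\<Sum>b\<le>m. real (m choose b) * (real d - 1) ^ (m - b) * (b / (l + b)) * of_bool (l / (1 - q) \<le> real (l + b)) / real d ^ m)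
    \<ge> q * (1 - exp (- (l * (\<rho> - q / (1 - q) + q / (1 - q) * ln (q / (1 - q) / \<rho>)))))"
proof -
  define \<beta> where "\<beta> = q / (1 - q)"
  \<comment> \<open>The minimiser of the Chernoff exponent \<rho> (\<sigma> - 1) - \<beta> ln
    \<sigma>.\<close>
  define \<sigma> where "\<sigma> = \<beta> / \<rho>"
  have \<beta>: "0 < \<beta>" "\<beta> < \<rho>" using q \<rho> by (auto simp: \<beta>_def)
  then have \<sigma>: "0 < \<sigma>" "\<sigma> < 1" by (auto simp: \<sigma>_def)
  have iff: "l / (1 - q) \<le> real (l + b) \<longleftrightarrow> \<beta> * l \<le> b" for b
    using q by (simp add: \<beta>_def field_simps)
  define w where "w b = real (m choose b) * (real d - 1) ^ (m - b) / real d ^ m" for b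
  have w: "0 \<le> w b" for b using d by (simp add: w_def)
  have "(\<Sum>b\<le>m. real (m choose b) * (real d - 1) ^ (m - b) * of_bool (\<not> \<beta> * l \<le> b) / real d ^ m)
     \<le> exp (real m * (\<sigma> - 1) / d - (\<beta> * l) * ln \<sigma>)"
    using \<sigma> by (intro chernoff_binomial d) (auto intro: mult_right_mono_neg)
  also have "real m * (\<sigma> - 1) / d - (\<beta> * l) * ln \<sigma> \<le> \<rho> * l * (\<sigma> - 1) - (\<beta> * l) * ln \<sigma>"
    using mult_right_mono_neg[OF m, of "\<sigma> - 1"] \<sigma> d by (simp add: field_simps)
  also have "\<dots> = - (l * (\<rho> - \<beta> + \<beta> * ln \<sigma>))"
    using \<beta> by (simp add: \<sigma>_def field_simps)
  finally have tail: "(\<Sum>b\<le>m. w b * of_bool (\<not> \<beta> * l \<le> b)) \<le> exp (- (l * (\<rho> - \<beta> + \<beta> * ln \<sigma>)))"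
    by (simp add: w_def)
  have "q * (1 - exp (- (l * (\<rho> - \<beta> + \<beta> * ln \<sigma>))))
      \<le> q * (\<Sum>b\<le>m. w b - w b * of_bool (\<not> \<beta> * l \<le> b))"
    using tail q binomial_weights_sum[OF d, of m] by (simp add: sum_subtractf w_def)
  also have "\<dots> = (\<Sum>b\<le>m. w b * (q * of_bool (\<beta> * l \<le> b)))"
    by (auto simp: sum_distrib_left intro!: sum.cong)
  also have "\<dots> \<le> (\<Sum>b\<le>m. w b * (b / (l + b) * of_bool (l / (1 - q) \<le> real (l + b))))"
  proof (intro sum_mono mult_left_mono w)
    fix b
    have "q \<le> b / (l + b)" if "\<beta> * l \<le> b"
      using that q l by (simp add: \<beta>_def field_simps)
    then show "q * of_bool (\<beta> * l \<le> b) \<le> b / (l + b) * of_bool (l / (1 - q) \<le> real (l + b))"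
      unfolding iff by auto
  qed
  finally show ?thesis
    by (simp add: \<beta>_def \<sigma>_def w_def mult_ac)
qed

text \<open>A union bound over all secrets. Agreements of a wrong codeword are binomial with mean
  about \<rho> l, and the Chernoff parameter 1/q is the ratio of the threshold l / (1 - q) to this
  mean when \<rho> is q / (1 - q).\<close>

lemma random_code_error_bound:
  fixes q \<rho> r :: real and l m :: nat
  assumes q: "0 < q" "q < 1" and r: "0 \<le> r" and l: "0 < l"
    and m: "m \<le> \<rho> * l * l + 1"
  shows "real (num_secrets (real_of_int \<lceil>r * l\<rceil>)) *
    (\<Sum>k\<le>l + m. real (l + m choose k) * (real l - 1) ^ (l + m - k) * of_bool (l / (1 - q) \<le> real k) / real l ^ (l + m))
    \<le> exp (l * (r * ln 2 + \<rho> * (1 / q - 1) + ln q / (1 - q)) + (ln 2 + 2 * (1 / q - 1)))"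
proof -
  have "real (num_secrets (real_of_int \<lceil>r * l\<rceil>)) = exp (real (nat \<lceil>r * l\<rceil>) * ln 2)"
    by (simp add: exp_of_nat_mult)
  also have "\<dots> \<le> exp ((r * l + 1) * ln 2)"
    using r by (simp add: of_int_ceiling_le_add_one)
  finally have M: "real (num_secrets (real_of_int \<lceil>r * l\<rceil>)) \<le> exp ((r * l + 1) * ln 2)" .
  have "(\<Sum>k\<le>l + m. real (l + m choose k) * (real l - 1) ^ (l + m - k) * of_bool (l / (1 - q) \<le> real k) / real l ^ (l + m))
     \<le> exp (real (l + m) * (1 / q - 1) / l - l / (1 - q) * ln (1 / q))"
  proof (intro chernoff_binomial l)
    fix k assume "l / (1 - q) \<le> real k"
    then show "l / (1 - q) * ln (1 / q) \<le> real k * ln (1 / q)"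
      using q by (intro mult_right_mono) (auto simp: ln_div)
  qed (use q in simp)
  also have "real (l + m) * (1 / q - 1) / l - l / (1 - q) * ln (1 / q)
      \<le> (\<rho> * l + 2) * (1 / q - 1) + l / (1 - q) * ln q"
  proof -
    \<comment> \<open>The knowers add \<open>l\<close> players and the rounding of \<open>m\<close>
      at most 1, together at most \<open>2 * l\<close>.\<close>
    have "real (l + m) \<le> (\<rho> * l + 2) * l" using m l by (simp add: algebra_simps)
    then have "real (l + m) * (1 / q - 1) \<le> (\<rho> * l + 2) * l * (1 / q - 1)"
      using q by (intro mult_right_mono) auto
    then have "real (l + m) * (1 / q - 1) / l \<le> (\<rho> * l + 2) * (1 / q - 1)"
      using l by (simp only: pos_divide_le_eq of_nat_0_less_iff mult_ac)
    moreover have "ln (1 / q) = - ln q" using q by (simp add: ln_div)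
    ultimately show ?thesis by simp
  qed
  finally have "real (num_secrets (real_of_int \<lceil>r * l\<rceil>)) *
    (\<Sum>k\<le>l + m. real (l + m choose k) * (real l - 1) ^ (l + m - k) * of_bool (l / (1 - q) \<le> real k) / real l ^ (l + m))
    \<le> exp ((r * l + 1) * ln 2) * exp ((\<rho> * l + 2) * (1 / q - 1) + l / (1 - q) * ln q)"
    using M l by (intro mult_mono sum_nonneg) auto
  also have "\<dots> = exp (l * (r * ln 2 + \<rho> * (1 / q - 1) + ln q / (1 - q)) + (ln 2 + 2 * (1 / q - 1)))"
    by (simp add: exp_add[symmetric] algebra_simps)
  finally show ?thesis .
qed

lemma exp_neg_linear_tendsto_0:
  fixes \<kappa> C :: real
  assumes "0 < \<kappa>"
  shows "(\<lambda>l::nat. exp (- (real l * \<kappa>) + C)) \<longlonglongrightarrow> 0"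
proof -
  have "(\<lambda>l. exp (- \<kappa>) ^ l * exp C) \<longlonglongrightarrow> 0 * exp C"
    using assms by (intro tendsto_intros LIMSEQ_power_zero) auto
  moreover have "exp (- \<kappa>) ^ l * exp C = exp (- (real l * \<kappa>) + C)" for l
    by (simp only: exp_add exp_of_nat_mult[symmetric] mult_minus_right)
  ultimately show ?thesis by simp
qed

text \<open>Passing from \<open>p\<close> to \<open>q\<close> leaves a slack \<open>\<gamma>\<close>
  in the rate, in nats per knower. Half of it lifts the mean number of agreeing non-knowers above
  the threshold; the other half remains as decay rate of the error.\<close>

lemma eventually_Succ_gt:
  fixes p q y :: real
  assumes "0 < q" "q < p" "p < 1" "y < q"
  shows "\<forall>\<^sub>F l in sequentially.
    y < Succ (real_of_int \<lceil>((- log 2 p) / (1 - p) - log 2 (exp 1)) * real l\<rceil>) l"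
proof -
  define r where "r = (- log 2 p) / (1 - p) - log 2 (exp 1)"
  define \<beta> where "\<beta> = q / (1 - q)"
  define \<gamma> where "\<gamma> = - ln q / (1 - q) - (- ln p / (1 - p))"
  define \<rho> where "\<rho> = \<beta> + \<gamma> / 2 * \<beta>"
  \<comment> \<open>The exponent of \<open>random_code_gain_lower_bound\<close>, positive because
    \<open>\<rho>\<close> exceeds \<open>\<beta>\<close>.\<close>
  define \<kappa> where "\<kappa> = \<rho> - \<beta> + \<beta> * ln (\<beta> / \<rho>)"
  define C where "C = ln 2 + 2 * (1 / q - 1)"
  have q: "0 < q" "q < 1" using assms by auto
  have "r = (- ln p / (1 - p) - 1) / ln 2"
    by (simp add: r_def log_def diff_divide_distrib mult.commute)
  then have r_ln: "r * ln 2 = - ln p / (1 - p) - 1"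
    by simp
  have "ln p \<le> p - 1" using assms by (intro ln_le_minus_one) auto
  then have "0 \<le> r * ln 2" using assms unfolding r_ln by (simp add: field_simps)
  then have r: "0 \<le> r" by (simp add: zero_le_mult_iff)
  have \<gamma>: "0 < \<gamma>" using rate_strict_antimono[of q p] assms by (simp add: \<gamma>_def)
  have \<beta>: "0 < \<beta>" using q by (simp add: \<beta>_def)
  have \<rho>: "\<beta> < \<rho>" using \<beta> \<gamma> by (simp add: \<rho>_def)
  have exponent: "r * ln 2 + \<rho> * (1 / q - 1) + ln q / (1 - q) = - (\<gamma> / 2)"
  proof -
    \<comment> \<open>This 1 cancels against the \<open>log 2 (exp 1)\<close> of the rate.\<close>
    have "\<beta> * (1 / q - 1) = 1" using q by (simp add: \<beta>_def field_simps)
    then have "\<rho> * (1 / q - 1) = 1 + \<gamma> / 2"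
      by (simp add: \<rho>_def distrib_right mult.assoc)
    moreover have "r * ln 2 = - (ln p / (1 - p)) - 1" "\<gamma> = ln p / (1 - p) - ln q / (1 - q)"
      using r_ln by (simp_all add: \<gamma>_def)
    ultimately show ?thesis by linarith
  qed
  have \<kappa>: "0 < \<kappa>"
  proof -
    have "ln (\<rho> / \<beta>) < \<rho> / \<beta> - 1"
      using \<beta> \<rho> ln_eq_minus_one[of "\<rho> / \<beta>"] ln_le_minus_one[of "\<rho> / \<beta>"] by force
    then have "\<beta> * ln (\<rho> / \<beta>) < \<beta> * (\<rho> / \<beta> - 1)"
      using \<beta> by (intro mult_strict_left_mono)
    then show ?thesis using \<beta> \<rho> by (simp add: \<kappa>_def ln_div algebra_simps)
  qed
  let ?e1 = "\<lambda>l::nat. exp (- (real l * \<kappa>) + 0)" and ?e2 = "\<lambda>l::nat. exp (- (real l * (\<gamma> / 2)) + C)"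
  have e1: "?e1 \<longlonglongrightarrow> 0" using \<kappa> by (rule exp_neg_linear_tendsto_0)
  have e2: "?e2 \<longlonglongrightarrow> 0" using \<gamma> by (intro exp_neg_linear_tendsto_0) auto
  have "(\<lambda>l. q * (1 - ?e1 l) * (1 - ?e2 l)) \<longlonglongrightarrow> q * (1 - 0) * (1 - 0)"
    by (intro tendsto_intros e1 e2)
  then have "\<forall>\<^sub>F l in sequentially. y < q * (1 - ?e1 l) * (1 - ?e2 l)"
    using assms(4) by (intro order_tendstoD) auto
  moreover have "\<forall>\<^sub>F l in sequentially. ?e2 l < 1"
    using e2 by (intro order_tendstoD) auto
  ultimately show ?thesis
    using eventually_gt_at_top[of 0]
  proof eventually_elim
    case (elim l)
    \<comment> \<open>The alphabet size is \<open>l\<close> itself: the \<open>l\<close> positions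
      of the knowers then raise the mean number of accidental agreements only by 1, while that of
      the non-knowers is about \<rho> l.\<close>
    define m where "m = nat \<lceil>\<rho> * l * l\<rceil>"
    have "0 \<le> \<rho> * l * l" using \<beta> \<rho> by simp
    then have m: "\<rho> * l * l \<le> m" "m \<le> \<rho> * l * l + 1"
      by (auto simp: m_def of_int_ceiling_le_add_one)
    let ?h = "real_of_int \<lceil>r * l\<rceil>" and ?P = "\<lambda>k. l / (1 - q) \<le> real k"
    let ?\<mu> = "\<Sum>b\<le>m. real (m choose b) * (real l - 1) ^ (m - b) * (b / (l + b)) * of_bool (?P (l + b)) / real l ^ m"
    let ?\<eta> = "\<Sum>k\<le>l + m. real (l + m choose k) * (real l - 1) ^ (l + m - k) * of_bool (?P k) / real l ^ (l + m)"
    have \<mu>: "q * (1 - ?e1 l) \<le> ?\<mu>"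
      using random_code_gain_lower_bound[OF q, of \<rho> l l m] \<rho> elim m by (simp add: \<beta>_def \<kappa>_def)
    have "real (num_secrets ?h) * ?\<eta> \<le> exp (l * (r * ln 2 + \<rho> * (1 / q - 1) + ln q / (1 - q)) + (ln 2 + 2 * (1 / q - 1)))"
      using random_code_error_bound[OF q r elim(3) m(2)] .
    then have \<eta>: "real (num_secrets ?h) * ?\<eta> \<le> ?e2 l"
      unfolding exponent C_def by simp
    have "0 \<le> ?\<mu>" using elim by (intro sum_nonneg) auto
    have "y < q * (1 - ?e1 l) * (1 - ?e2 l)" by (rule elim)
    also have "\<dots> \<le> ?\<mu> * (1 - ?e2 l)" using \<mu> elim by (intro mult_right_mono) auto
    also have "\<dots> \<le> ?\<mu> * (1 - real (num_secrets ?h) * ?\<eta>)"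
      using \<eta> \<open>0 \<le> ?\<mu>\<close> by (intro mult_left_mono) auto
    also have "\<dots> \<le> Succ_n ?h l (l + m)"
      using Succ_n_ge_random_code[OF elim(3) elim(3), where P = ?P and m = m and h = ?h] .
    also have "\<dots> \<le> Succ ?h l"
      using elim by (intro Succ_n_le_Succ) auto
    finally show ?case by (simp add: r_def)
  qed
qed

theorem theorem5p4:
  fixes p :: real
  assumes "0 < p" and "p < 1"
  shows "Liminf sequentially
           (\<lambda>l. ereal (Succ (real_of_int \<lceil>((- log 2 p) / (1 - p) - log 2 (exp 1)) * real l\<rceil>) l))
         \<ge> ereal p"
  unfolding le_Liminf_iff
proof (intro allI impI)
  fix y assume y: "y < ereal p"
  \<comment> \<open>\<open>y\<close> may be negative or minus infinity; the maximum with 0 yields a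
    positive real \<open>z\<close>, hence a positive \<open>q\<close>.\<close>
  then have "max y 0 < ereal p" using assms(1) by simp
  then obtain z where z: "max y 0 < ereal z" "ereal z < ereal p"
    using ereal_dense2 by blast
  then obtain q where q: "z < q" "q < p" using dense by auto
  then have "\<forall>\<^sub>F l in sequentially.
      z < Succ (real_of_int \<lceil>((- log 2 p) / (1 - p) - log 2 (exp 1)) * real l\<rceil>) l"
    using assms z by (intro eventually_Succ_gt[of q]) auto
  then show "\<forall>\<^sub>F l in sequentially.
      y < ereal (Succ (real_of_int \<lceil>((- log 2 p) / (1 - p) - log 2 (exp 1)) * real l\<rceil>) l)"
    by eventually_elim (use z in \<open>auto elim: order.strict_trans\<close>)
qed

end
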